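(* Let $\{p_{\boldsymbol\theta}\}$ be a $d$-parameter statistical model with parameter space $\Theta\subset\mathbb{R}^d$, satisfying (A1)--(A2) and (R1)--(R5) (listed in the context). For fixed $0<\delta\le 1$ and $d<\infty$, let $M=M(\epsilon)$ be the minimal number of repetitions required to guarantee that the maximum-likelihood estimator satisfies $$\Pr\big[\|\tilde{\boldsymbol\theta}^{\mathrm{ML}}-\boldsymbol\theta\|_\infty\le\epsilon\big]\ge 1-\delta\quad\text{for all }\boldsymbol\theta\in\Theta ,$$ i.e. the minimal number $M_0$ such that this guarantee holds for all numbers of repetitions $\ge M_0$. Then, in the small-error limit $\epsilon\to0$, $$M\lesssim W_0(8\pi^{-1}\delta^{-2}d^2)\,\sup_{\boldsymbol\theta\in\Theta}\max_{a\in[d]}[\mathbf F_{\boldsymbol\theta}^{-1}]_{aa}\,\epsilon^{-2} .$$ Equivalently, the minimal sample complexity $N_{\mathrm{samp}}=N_{\mathcal E}M$ is upper bounded as $$N_{\mathrm{samp}}\lesssim N_{\mathcal E}\,W_0(8\pi^{-1}\delta^{-2}d^2)\,\sup_{\boldsymbol\theta\in\Theta}\max_{a\in[d]}[\mathbf F_{\boldsymbol\theta}^{-1}]_{aa}\,\epsilon^{-2} .$$ Here $A_\epsilon\lesssim B_\epsilon$ means $\limsup_{\epsilon\to0}A_\epsilon/B_\epsilon\le1$ with $\delta$ and $d$ fixed.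
   Context: Setting. $p_{\boldsymbol\theta}(x)$ is the probability of outcome $x$ in one run of a fixed quantum estimation protocol, $p_{\boldsymbol\theta}(x)=\mathrm{Tr}[\hat\Pi_x\mathcal E_{\boldsymbol\theta}(\hat\rho_0)]$, where $\hat\rho_0$ is a fixed state, $\mathcal E_{\boldsymbol\theta}$ a parametrized quantum channel that uses an elementary parameter-dependent channel a fixed number $N_{\mathcal E}$ of times, and $\{\hat\Pi_x\}_x$ a POVM. The protocol is repeated independently $M$ times, giving i.i.d. outcomes $\boldsymbol x=(x_1,\dots,x_M)$ with law $\prod_i p_{\boldsymbol\theta}(x_i)$, $\boldsymbol\theta$ being the true parameter; $\Pr$ and $\mathbb E_{\boldsymbol\theta}$ refer to this law, and $X$ denotes a single outcome. The sample complexity is $N_{\mathrm{samp}}=MN_{\mathcal E}$. Notation. $[d]=\{1,\dots,d\}$. $\ell_{\boldsymbol\theta}(x)=\log p_{\boldsymbol\theta}(x)$, with gradient $\ell^{(1)}_{\boldsymbol\theta}(x)\in\mathbb R^d$, Hessian $\ell^{(2)}_{\boldsymbol\theta}(x)\in\mathbb R^{d\times d}$ and third-derivative tensor $\ell^{(3)}_{\boldsymbol\theta}(x)\in\mathbb R^{d\times d\times d}$ with respect to $\boldsymbol\theta$; $\ell_{\boldsymbol\theta}(\boldsymbol x)=\sum_{i=1}^M\ell_{\boldsymbol\theta}(x_i)$. The Fisher information matrix is $\mathbf F_{\boldsymbol\theta}=\mathbb E_{\boldsymbol\theta}[\ell^{(1)}_{\boldsymbol\theta}(X)\ell^{(1)}_{\boldsymbol\theta}(X)^{\mathsf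 T}]$, with $\mathbb E_{\boldsymbol\theta}[\ell^{(1)}_{\boldsymbol\theta}(X)]=0$ and $\mathbb E_{\boldsymbol\theta}[\ell^{(2)}_{\boldsymbol\theta}(X)]=-\mathbf F_{\boldsymbol\theta}$. $\tilde{\boldsymbol\theta}^{\mathrm{ML}}=\tilde{\boldsymbol\theta}^{\mathrm{ML}}(\boldsymbol x)$ is the maximizer of $\boldsymbol\theta\mapsto\ell_{\boldsymbol\theta}(\boldsymbol x)$ over $\Theta$. $\|\boldsymbol v\|_\infty=\max_i|v_i|$ and $\|\cdot\|_2$ is the Euclidean norm. $\|\cdot\|_{\mathrm{op}}$ is the Euclidean operator norm for matrices, and for a third-order tensor $\mathbf T$ it is $\sup|\sum_{ijk}T_{ijk}u_iv_jw_k|$ over Euclidean unit vectors $u,v,w$. $W_0$ is the principal branch of the Lambert $W$ function. Assumptions. (A1) Unique maximizer and stationary point: $\ell_{\boldsymbol\theta}(\boldsymbol x)$ has a unique maximizer $\tilde{\boldsymbol\theta}^{\mathrm{ML}}$ in the interior of the parameter domain $\Theta$, which is also the unique stationary point. (A2) Smoothness: $\ell_{\boldsymbol\theta}(\boldsymbol x)$ is three times continuously differentiable with respect to $\boldsymbol\theta$ on the parameter domain $\Theta$. (R1) Let $\widetilde\Theta$ be an open ambient parameter domain containing $\Theta$. There exists $r_0>0$ such that $\boldsymbol\theta+\boldsymbol\Delta\in\widetilde\Theta$ for all $\boldsymbol\theta\in\Theta$ and $\|\boldsymbol\Delta\|_2\le r_0$. (R2) $\mathbf F_{\boldsymbol\theta}$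 is non-singular for every $\boldsymbol\theta\in\Theta$ and $\sup_{\boldsymbol\theta\in\Theta}\|\mathbf F_{\boldsymbol\theta}^{-1}\|_{\mathrm{op}}<\infty$. (R3) $\sup_{\boldsymbol\theta\in\Theta}\mathbb E_{\boldsymbol\theta}[\mathrm{Tr}\{(\ell^{(2)}_{\boldsymbol\theta}(X)+\mathbf F_{\boldsymbol\theta})^2\}]<\infty$. (R4) $\sup_{\boldsymbol\theta\in\Theta}\mathbb E_{\boldsymbol\theta}[(\sup_{\|\boldsymbol\Delta\|_2\le r_0}\|\ell^{(3)}_{\boldsymbol\theta+\boldsymbol\Delta}(X)\|_{\mathrm{op}})^2]<\infty$. (R5) $\sup_{\boldsymbol\theta\in\Theta}\sup_{\|\boldsymbol u\|_2=1}\dfrac{\mathbb E_{\boldsymbol\theta}[|\boldsymbol u^{\mathsf T}\mathbf F_{\boldsymbol\theta}^{-1}\ell^{(1)}_{\boldsymbol\theta}(X)|^3]}{(\boldsymbol u^{\mathsf T}\mathbf F_{\boldsymbol\theta}^{-1}\boldsymbol u)^{3/2}}<\infty$.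
   Formalization: In (A1) the maximizer is required to be the only stationary point in the whole ambient domain Θ̃, not just in Θ (otherwise the claim fails, e.g. for a location family on two separated half-lines glued at the ends), and the smoothness in (A2) is required on Θ̃. *)

theory Defs
  imports "HOL-Probability.Probability"
begin

subsection \<open>Derivatives up to order three\<close>

definition gradient :: "(real^'d::finite \<Rightarrow> real) \<Rightarrow> real^'d \<Rightarrow> real^'d" where
  "gradient f t = (\<chi> i. frechet_derivative f (at t) (axis i 1))"

definition hessian :: "(real^'d::finite \<Rightarrow> real) \<Rightarrow> real^'d \<Rightarrow> real^'d^'d" where
  "hessian f t = (\<chi> i j. frechet_derivative (\<lambda>s. gradient f s $ i) (at t) (axis j 1))"

definition third_deriv :: "(real^'d::finite \<Rightarrow> real) \<Rightarrow> real^'d \<Rightarrow> real^'d^'d^'d" where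
  "third_deriv f t = (\<chi> i j k. frechet_derivative (\<lambda>s. hessian f s $ i $ j) (at t) (axis k 1))"

text \<open>Three times continuously differentiable; only meant for open \<open>S\<close>, where the derivatives
  \<open>at t\<close> used above and those \<open>at t within S\<close> coincide.\<close>

definition C3_on :: "(real^'d::finite) set \<Rightarrow> (real^'d \<Rightarrow> real) \<Rightarrow> bool" where
  "C3_on S f \<longleftrightarrow>
     f differentiable_on S \<and> gradient f differentiable_on S \<and> hessian f differentiable_on S \<and>
     continuous_on S (third_deriv f)"

definition tensor_opnorm :: "real^'d^'d^'d::finite \<Rightarrow> real" where
  "tensor_opnorm T =
     (SUP (u, v, w) \<in> sphere 0 1 \<times> sphere 0 1 \<times> sphere 0 1.
        \<bar>\<Sum>i\<in>UNIV. \<Sum>j\<in>UNIV. \<Sum>k\<in>UNIV. T $ i $ j $ k * u $ i * v $ j * w $ k\<bar>)"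

definition matrix_opnorm :: "real^'d^'d::finite \<Rightarrow> real" where
  "matrix_opnorm A = onorm (\<lambda>v. A *v v)"

definition outer_square :: "real^'d::finite \<Rightarrow> real^'d^'d" where
  "outer_square v = (\<chi> i j. v $ i * v $ j)"

subsection \<open>Statistical models\<close>

text \<open>A model is a family of densities \<open>p \<theta>\<close> with respect to a measure \<open>\<mu>\<close> on the outcome space.
  With \<open>\<mu>\<close> a counting measure, \<open>p \<theta> x\<close> is the probability of the outcome \<open>x\<close> (for a POVM, the trace
  of its element \<open>x\<close> against the output state); other choices of \<open>\<mu>\<close> give measurements with
  continuous outcomes.\<close>

definition law :: "'x measure \<Rightarrow> ('p \<Rightarrow> 'x \<Rightarrow> real) \<Rightarrow> 'p \<Rightarrow> 'x measure" where
  "law \<mu> p \<theta> = density \<mu> (\<lambda>x. ennreal (p \<theta> x))"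

definition iid_law :: "'x measure \<Rightarrow> ('p \<Rightarrow> 'x \<Rightarrow> real) \<Rightarrow> nat \<Rightarrow> 'p \<Rightarrow> (nat \<Rightarrow> 'x) measure" where
  "iid_law \<mu> p M \<theta> = (\<Pi>\<^sub>M i\<in>{..<M}. law \<mu> p \<theta>)"

definition loglik :: "('p \<Rightarrow> 'x \<Rightarrow> real) \<Rightarrow> 'x \<Rightarrow> 'p \<Rightarrow> real" where
  "loglik p x \<theta> = ln (p \<theta> x)"

definition sample_loglik :: "('p \<Rightarrow> 'x \<Rightarrow> real) \<Rightarrow> nat \<Rightarrow> (nat \<Rightarrow> 'x) \<Rightarrow> 'p \<Rightarrow> real" where
  "sample_loglik p M xs \<theta> = (\<Sum>i<M. loglik p (xs i) \<theta>)"

definition fisher :: "'x measure \<Rightarrow> (real^'d::finite \<Rightarrow> 'x \<Rightarrow> real) \<Rightarrow> real^'d \<Rightarrow> real^'d^'d" where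
  "fisher \<mu> p \<theta> = (\<integral>x. outer_square (gradient (loglik p x) \<theta>) \<partial>law \<mu> p \<theta>)"

definition fisher_inv :: "'x measure \<Rightarrow> (real^'d::finite \<Rightarrow> 'x \<Rightarrow> real) \<Rightarrow> real^'d \<Rightarrow> real^'d^'d" where
  "fisher_inv \<mu> p \<theta> = matrix_inv (fisher \<mu> p \<theta>)"

definition mle :: "(real^'d::finite) set \<Rightarrow> (real^'d \<Rightarrow> 'x \<Rightarrow> real) \<Rightarrow> nat \<Rightarrow> (nat \<Rightarrow> 'x) \<Rightarrow> real^'d" where
  "mle \<Theta> p M xs = arg_max_on (sample_loglik p M xs) \<Theta>"

subsection \<open>Number of repetitions\<close>

text \<open>The estimator is only determined up to a null set of samples, hence the completed law:
  its measure does not depend on what \<open>arg_max_on\<close> returns on that null set.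
  \<open>infnorm\<close> is the maximum norm.\<close>

definition ml_guarantee ::
  "'x measure \<Rightarrow> (real^'d::finite) set \<Rightarrow> (real^'d \<Rightarrow> 'x \<Rightarrow> real) \<Rightarrow> real \<Rightarrow> real \<Rightarrow> nat \<Rightarrow> bool" where
  "ml_guarantee \<mu> \<Theta> p \<delta> \<epsilon> M \<longleftrightarrow>
     (\<forall>\<theta>\<in>\<Theta>. measure (completion (iid_law \<mu> p M \<theta>))
        {xs \<in> space (iid_law \<mu> p M \<theta>). infnorm (mle \<Theta> p M xs - \<theta>) \<le> \<epsilon>} \<ge> 1 - \<delta>)"

text \<open>The infimum is \<open>\<infinity>\<close> if no number of repetitions is sufficient.\<close>

definition min_repetitions ::
  "'x measure \<Rightarrow> (real^'d::finite) set \<Rightarrow> (real^'d \<Rightarrow> 'x \<Rightarrow> real) \<Rightarrow> real \<Rightarrow> real \<Rightarrow> enat" where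
  "min_repetitions \<mu> \<Theta> p \<delta> \<epsilon> =
     (INF M0 \<in> {M0. 1 \<le> M0 \<and> (\<forall>M\<ge>M0. ml_guarantee \<mu> \<Theta> p \<delta> \<epsilon> M)}. enat M0)"

definition min_sample_complexity ::
  "nat \<Rightarrow> 'x measure \<Rightarrow> (real^'d::finite) set \<Rightarrow> (real^'d \<Rightarrow> 'x \<Rightarrow> real) \<Rightarrow> real \<Rightarrow> real \<Rightarrow> enat" where
  "min_sample_complexity N \<mu> \<Theta> p \<delta> \<epsilon> = enat N * min_repetitions \<mu> \<Theta> p \<delta> \<epsilon>"

definition asymp_le_at_0 :: "(real \<Rightarrow> enat) \<Rightarrow> (real \<Rightarrow> real) \<Rightarrow> bool" where
  "asymp_le_at_0 A B \<longleftrightarrow>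
     Limsup (at_right 0) (\<lambda>\<epsilon>. ereal_of_enat (A \<epsilon>) / ereal (B \<epsilon>)) \<le> 1"

text \<open>Principal branch of the Lambert function, for real arguments \<open>y \<ge> - exp (- 1)\<close>.\<close>

definition lambert_W0 :: "real \<Rightarrow> real" where
  "lambert_W0 y = (THE w. - 1 \<le> w \<and> w * exp w = y)"

definition worst_variance :: "'x measure \<Rightarrow> (real^'d::finite) set \<Rightarrow> (real^'d \<Rightarrow> 'x \<Rightarrow> real) \<Rightarrow> real" where
  "worst_variance \<mu> \<Theta> p = (SUP \<theta>\<in>\<Theta>. MAX a. fisher_inv \<mu> p \<theta> $ a $ a)"

end

theory Submission
  imports Defs "HOL-Real_Asymp.Real_Asymp"
begin

text \<open>By (A1) the estimator is almost surely the only stationary point, so it is enough to find, with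
  probability at least \<open>1 - \<delta>\<close>, some stationary point in the cube of radius \<open>\<epsilon>\<close> around \<open>\<theta>\<close>. The map
  \<open>\<Delta> \<mapsto> \<Delta> + F\<^sup>-\<^sup>1 g (\<theta> + \<Delta>)\<close>, with \<open>g\<close> the averaged score, sends this cube to itself as soon as
  \<open>F\<^sup>-\<^sup>1 g \<theta>\<close> lies in the slightly smaller cube of radius \<open>(1 - \<kappa>) \<epsilon>\<close>, the averaged Hessian is close to
  \<open>- F\<close> and the averaged third derivatives are bounded; Brouwer's theorem then gives a zero of \<open>g\<close>.
  The last two events fail with small probability, uniformly in \<open>\<theta>\<close>, by the inequalities of Chebyshev
  (R3) and Markov (R4). For the first one, a central limit theorem that is uniform over \<open>\<Theta>\<close> (R5)
  and the Mills ratio bound show that each of the \<open>d\<close> coordinates fails with probability at most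
  about \<open>2 \<phi> t / t\<close>, where \<open>t\<^sup>2 = M \<epsilon>\<^sup>2 / [F\<^sup>-\<^sup>1]\<^sub>a\<^sub>a\<close> is at least the value \<open>W\<^sub>0\<close> for the stated \<open>M\<close>. This is
  \<open>\<delta> / (2 d)\<close> by the equation that defines \<open>W\<^sub>0\<close>, so that half of \<open>\<delta>\<close> remains to absorb all errors.\<close>

subsection \<open>Derivatives along lines and Taylor expansion of the gradient\<close>

text \<open>The guarantee is required for every \<open>M\<close> beyond the threshold, and one
  threshold must serve all parameters. Therefore the level t of the normal tail stays fixed while
  \<open>M\<close> and the error e move independently; they are tied only by \<open>t * sqrt V *
  sqrt (real M) \<le> real M * ((1 - \<kappa>) * e)\<close>, which remains true when
  \<open>M\<close> grows. As e tends to 0 the admissible \<open>M\<close> tend to infinity, so a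
  limit theorem at a fixed level is enough and no rate of convergence enters.

  The argument of the Lambert function is what remains after squaring 2 d phi(t) / t = \<delta> / 2
  with t^2 = W; the factor 8 already contains the halving of \<delta>. The loss \<kappa> costs the
  factor 1 / (1 - \<kappa>)^2 in \<open>M\<close>, which tends to 1 with \<kappa> and so disappears
  in the upper limit.

  A further obstacle is measurability: \<open>arg_max_on\<close> need not depend measurably on the
  sample. All probabilities are therefore computed for the event that some stationary point lies in
  the cube, and transferred to the estimator through the completed law.\<close>

lemma line_has_real_derivative:
  fixes f :: "real^'d::finite \<Rightarrow> real"
  assumes "f differentiable (at (t + s *\<^sub>R h))"
  shows "((\<lambda>s. f (t + s *\<^sub>R h)) has_real_derivative gradient f (t + s *\<^sub>R h) \<bullet> h) (at s within A)"
proof -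
  let ?D = "frechet_derivative f (at (t + s *\<^sub>R h))"
  have D: "(f has_derivative ?D) (at (t + s *\<^sub>R h))"
    using assms frechet_derivative_works by blast
  then have lin: "linear ?D"
    using has_derivative_linear by blast
  have "((\<lambda>s. t + s *\<^sub>R h) has_derivative (\<lambda>x. x *\<^sub>R h)) (at s)"
    by (auto intro!: derivative_eq_intros)
  from has_derivative_compose[OF this D]
  have "((\<lambda>s. f (t + s *\<^sub>R h)) has_derivative (\<lambda>x. ?D (x *\<^sub>R h))) (at s)" .
  moreover have "?D (x *\<^sub>R h) = (gradient f (t + s *\<^sub>R h) \<bullet> h) * x" for x
  proof -
    have "?D h = ?D (\<Sum>i\<in>UNIV. h $ i *\<^sub>R axis i 1)"
      by (simp add: basis_expansion flip: scalar_mult_eq_scaleR)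
    also have "\<dots> = (\<Sum>i\<in>UNIV. h $ i * ?D (axis i 1))"
      by (simp add: linear_sum[OF lin] linear_scale[OF lin])
    also have "\<dots> = gradient f (t + s *\<^sub>R h) \<bullet> h"
      by (simp add: gradient_def inner_vec_def mult.commute)
    finally show ?thesis by (simp add: linear_scale[OF lin])
  qed
  ultimately have "((\<lambda>s. f (t + s *\<^sub>R h)) has_real_derivative gradient f (t + s *\<^sub>R h) \<bullet> h) (at s)"
    by (simp add: has_field_derivative_def)
  then show ?thesis by (rule has_field_derivative_at_within)
qed

lemma line_mvt:
  fixes f :: "real^'d::finite \<Rightarrow> real"
  assumes "a < b" "\<And>s. a \<le> s \<Longrightarrow> s \<le> b \<Longrightarrow> f differentiable (at (t + s *\<^sub>R h))"
  obtains s where "a < s" "s < b"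
    "f (t + b *\<^sub>R h) - f (t + a *\<^sub>R h) = (b - a) * (gradient f (t + s *\<^sub>R h) \<bullet> h)"
  using MVT2[OF assms(1), of "\<lambda>s. f (t + s *\<^sub>R h)" "\<lambda>s. gradient f (t + s *\<^sub>R h) \<bullet> h"]
    line_has_real_derivative[OF assms(2)] by metis

lemma hessian_nth: "hessian f t $ i = gradient (\<lambda>s. gradient f s $ i) t"
  by (simp add: hessian_def gradient_def)

lemma third_deriv_nth: "third_deriv f t $ i $ j = gradient (\<lambda>s. hessian f s $ i $ j) t"
  by (simp add: third_deriv_def gradient_def)

lemma differentiable_vec_nth:
  "f differentiable F \<Longrightarrow> (\<lambda>x. f x $ i) differentiable F"
  unfolding differentiable_def using bounded_linear.has_derivative[OF bounded_linear_vec_nth] by blast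

lemma C3_onD:
  assumes "C3_on S f" "open S" "t \<in> S"
  shows "f differentiable (at t)" "(\<lambda>s. gradient f s $ i) differentiable (at t)"
    "(\<lambda>s. hessian f s $ i $ j) differentiable (at t)"
  using assms by (auto simp: C3_on_def differentiable_on_eq_differentiable_at
      intro!: differentiable_vec_nth)

lemma gradient_sum:
  assumes "finite I" "\<And>k. k \<in> I \<Longrightarrow> f k differentiable (at t)"
  shows "gradient (\<lambda>s. \<Sum>k\<in>I. f k s) t = (\<Sum>k\<in>I. gradient (f k) t)"
proof -
  have "((\<lambda>s. \<Sum>k\<in>I. f k s) has_derivative (\<lambda>h. \<Sum>k\<in>I. frechet_derivative (f k) (at t) h)) (at t)"
    using assms frechet_derivative_works by (intro has_derivative_sum) blast
  from frechet_derivative_at[OF this, symmetric] show ?thesis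
    by (simp add: gradient_def vec_eq_iff)
qed

text \<open>Two mean value steps: first in direction \<open>i\<close> for the difference
  \<open>?\<phi>\<close> of two parallel lines, then in direction \<open>j\<close> for entry
  \<open>i\<close> of the gradient. The order of the steps fixes the order of the two
  indices.\<close>

lemma mixed_difference_hessian:
  fixes f :: "real^'d::finite \<Rightarrow> real"
  assumes f: "C3_on S f" "open S" and h: "0 < h"
    and S: "\<And>a b. 0 \<le> a \<Longrightarrow> a \<le> h \<Longrightarrow> 0 \<le> b \<Longrightarrow> b \<le> h \<Longrightarrow> t + a *\<^sub>R axis i 1 + b *\<^sub>R axis j 1 \<in> S"
  obtains a b where "0 \<le> a" "a \<le> h" "0 \<le> b" "b \<le> h"
    "f (t + h *\<^sub>R axis i 1 + h *\<^sub>R axis j 1) - f (t + h *\<^sub>R axis i 1)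
       - f (t + h *\<^sub>R axis j 1) + f t
     = h\<^sup>2 * hessian f (t + a *\<^sub>R axis i 1 + b *\<^sub>R axis j 1) $ i $ j"
proof -
  let ?u = "axis i 1 :: real^'d" and ?v = "axis j 1 :: real^'d"
  let ?\<phi> = "\<lambda>s. f ((t + h *\<^sub>R ?v) + s *\<^sub>R ?u) - f (t + s *\<^sub>R ?u)"
  have S': "(t + h *\<^sub>R ?v) + s *\<^sub>R ?u \<in> S" "t + s *\<^sub>R ?u \<in> S" if "0 \<le> s" "s \<le> h" for s
    using S[of s h] S[of s 0] that h by (simp_all add: algebra_simps)
  have "(?\<phi> has_real_derivative gradient f ((t + h *\<^sub>R ?v) + s *\<^sub>R ?u) \<bullet> ?u
           - gradient f (t + s *\<^sub>R ?u) \<bullet> ?u) (at s)" if "0 \<le> s" "s \<le> h" for s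
    using that S' by (intro DERIV_diff line_has_real_derivative C3_onD(1)[OF f])
  from MVT2[OF h, of ?\<phi>, OF this]
  obtain a where a: "0 < a" "a < h"
    "?\<phi> h - ?\<phi> 0 = h * (gradient f ((t + h *\<^sub>R ?v) + a *\<^sub>R ?u) \<bullet> ?u - gradient f (t + a *\<^sub>R ?u) \<bullet> ?u)"
    by auto
  have "(\<lambda>s. gradient f s $ i) differentiable at (t + a *\<^sub>R ?u + s *\<^sub>R ?v)" if "0 \<le> s" "s \<le> h" for s
    using S[of a s] that a by (intro C3_onD(2)[OF f]) auto
  from line_mvt[OF h this] obtain b where b: "0 < b" "b < h"
    "gradient f (t + a *\<^sub>R ?u + h *\<^sub>R ?v) $ i - gradient f (t + a *\<^sub>R ?u) $ i
      = h * (hessian f (t + a *\<^sub>R ?u + b *\<^sub>R ?v) $ i \<bullet> ?v)"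
    by (auto simp: hessian_nth)
  show thesis
  proof (rule that)
    show "f (t + h *\<^sub>R ?u + h *\<^sub>R ?v) - f (t + h *\<^sub>R ?u) - f (t + h *\<^sub>R ?v) + f t
      = h\<^sup>2 * hessian f (t + a *\<^sub>R ?u + b *\<^sub>R ?v) $ i $ j"
      using a(3) b(3) by (simp add: inner_axis algebra_simps power2_eq_square)
  qed (use a b in auto)
qed

text \<open>Schwarz's theorem. The mixed second difference does not change when \<open>i\<close> and
  \<open>j\<close> are exchanged, so the two mean value forms agree, at two points that both tend to
  \<open>t\<close>; differentiable Hessian entries are continuous. Symmetry is what makes the trace
  in (R3) a sum of squares.\<close>

lemma hessian_symmetric:
  fixes f :: "real^'d::finite \<Rightarrow> real"
  assumes f: "C3_on S f" "open S" and t: "t \<in> S"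
  shows "hessian f t $ i $ j = hessian f t $ j $ i"
proof (rule ccontr)
  assume neq: "\<not> ?thesis"
  define e where "e = \<bar>hessian f t $ i $ j - hessian f t $ j $ i\<bar> / 2"
  have e: "e > 0" using neq by (simp add: e_def)
  have cont: "continuous (at t) (\<lambda>s. hessian f s $ i $ j)" for i j
    using C3_onD(3)[OF f t] differentiable_imp_continuous_within by blast
  obtain r where r: "r > 0" "ball t r \<subseteq> S" using f(2) t open_contains_ball by blast
  obtain r1 where r1: "r1 > 0" "\<And>s. dist s t < r1 \<Longrightarrow> \<bar>hessian f s $ i $ j - hessian f t $ i $ j\<bar> < e"
    using cont[of i j] e unfolding continuous_at_eps_delta dist_real_def by blast
  obtain r2 where r2: "r2 > 0" "\<And>s. dist s t < r2 \<Longrightarrow> \<bar>hessian f s $ j $ i - hessian f t $ j $ i\<bar> < e"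
    using cont[of j i] e unfolding continuous_at_eps_delta dist_real_def by blast
  \<comment> \<open>A mean value point has distance at most \<open>2 * h\<close> from
    \<open>t\<close>; dividing by 3 keeps this below all three radii.\<close>
  define h where "h = min r (min r1 r2) / 3"
  have h: "0 < h" "2 * h < r" "2 * h < r1" "2 * h < r2" using r r1 r2 by (auto simp: h_def)
  have near: "dist (t + a *\<^sub>R axis i 1 + b *\<^sub>R axis j 1) t \<le> 2 * h"
    if "0 \<le> a" "a \<le> h" "0 \<le> b" "b \<le> h" for a b and i j :: 'd
  proof -
    have "dist (t + a *\<^sub>R axis i 1 + b *\<^sub>R axis j 1) t
        \<le> norm (a *\<^sub>R (axis i 1 :: real^'d)) + norm (b *\<^sub>R (axis j 1 :: real^'d))"
      unfolding dist_norm add.assoc add_diff_cancel_left' by (rule norm_triangle_ineq)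
    also have "\<dots> \<le> 2 * h" using that by simp
    finally show ?thesis .
  qed
  have inS: "t + a *\<^sub>R axis i 1 + b *\<^sub>R axis j 1 \<in> S"
    if "0 \<le> a" "a \<le> h" "0 \<le> b" "b \<le> h" for a b and i j :: 'd
    using near[OF that, of i j] r h by (auto simp: subset_iff dist_commute)
  obtain a b where ab: "0 \<le> a" "a \<le> h" "0 \<le> b" "b \<le> h"
    "f (t + h *\<^sub>R axis i 1 + h *\<^sub>R axis j 1) - f (t + h *\<^sub>R axis i 1)
       - f (t + h *\<^sub>R axis j 1) + f t
     = h\<^sup>2 * hessian f (t + a *\<^sub>R axis i 1 + b *\<^sub>R axis j 1) $ i $ j"
    using mixed_difference_hessian[OF f h(1) inS] by blast
  obtain a' b' where ab': "0 \<le> a'" "a' \<le> h" "0 \<le> b'" "b' \<le> h"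
    "f (t + h *\<^sub>R axis j 1 + h *\<^sub>R axis i 1) - f (t + h *\<^sub>R axis j 1)
       - f (t + h *\<^sub>R axis i 1) + f t
     = h\<^sup>2 * hessian f (t + a' *\<^sub>R axis j 1 + b' *\<^sub>R axis i 1) $ j $ i"
    using mixed_difference_hessian[OF f h(1) inS] by blast
  have swap: "t + h *\<^sub>R axis j 1 + h *\<^sub>R axis i 1 = t + h *\<^sub>R axis i 1 + h *\<^sub>R axis j 1" by simp
  from ab(5) ab'(5)[unfolded swap] have "h\<^sup>2 * hessian f (t + a *\<^sub>R axis i 1 + b *\<^sub>R axis j 1) $ i $ j
      = h\<^sup>2 * hessian f (t + a' *\<^sub>R axis j 1 + b' *\<^sub>R axis i 1) $ j $ i"
    by linarith
  then have eq: "hessian f (t + a *\<^sub>R axis i 1 + b *\<^sub>R axis j 1) $ i $ j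
      = hessian f (t + a' *\<^sub>R axis j 1 + b' *\<^sub>R axis i 1) $ j $ i"
    using h(1) by simp
  have "\<bar>hessian f (t + a *\<^sub>R axis i 1 + b *\<^sub>R axis j 1) $ i $ j - hessian f t $ i $ j\<bar> < e"
    using near[OF ab(1-4), of i j] h by (intro r1(2)) simp
  moreover have "\<bar>hessian f (t + a' *\<^sub>R axis j 1 + b' *\<^sub>R axis i 1) $ j $ i - hessian f t $ j $ i\<bar> < e"
    using near[OF ab'(1-4), of j i] h by (intro r2(2)) simp
  ultimately show False
    unfolding eq e_def by (simp add: abs_if field_simps split: if_splits)
qed

lemma abs_inner_le_entries:
  fixes u v :: "real^'d::finite"
  assumes "\<And>i. \<bar>u $ i\<bar> \<le> a" "\<And>i. \<bar>v $ i\<bar> \<le> b"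
  shows "\<bar>u \<bullet> v\<bar> \<le> real CARD('d) * (a * b)"
proof -
  have "\<bar>u \<bullet> v\<bar> \<le> (\<Sum>i\<in>UNIV. \<bar>u $ i * v $ i\<bar>)"
    unfolding inner_vec_def inner_real_def by (rule sum_abs)
  also have "\<dots> \<le> (\<Sum>i\<in>(UNIV::'d set). a * b)"
    unfolding abs_mult by (intro sum_mono mult_mono assms abs_ge_zero order_trans[OF abs_ge_zero assms(1)])
  finally show ?thesis by simp
qed

text \<open>The mean value theorem is applied twice, to the gradient and then to the Hessian
  entries, and each inner product costs a factor \<open>CARD('d)\<close>. The usual factor 1/2 is
  given away, since only the order \<open>e\<^sup>2\<close> matters.\<close>

lemma gradient_taylor:
  fixes f :: "real^'d::finite \<Rightarrow> real"
  assumes f: "C3_on S f" "open S"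
    and S: "\<And>s. 0 \<le> s \<Longrightarrow> s \<le> 1 \<Longrightarrow> t + s *\<^sub>R h \<in> S"
    and G: "\<And>s i j k. 0 \<le> s \<Longrightarrow> s \<le> 1 \<Longrightarrow> \<bar>third_deriv f (t + s *\<^sub>R h) $ i $ j $ k\<bar> \<le> G"
    and e: "\<And>k. \<bar>h $ k\<bar> \<le> e"
  shows "\<bar>gradient f (t + h) $ i - gradient f t $ i - hessian f t $ i \<bullet> h\<bar> \<le> (real CARD('d))\<^sup>2 * G * e\<^sup>2"
proof -
  have e0: "0 \<le> e" using e abs_ge_zero order_trans by blast
  from line_mvt[OF zero_less_one C3_onD(2)[OF f S]] obtain x where x: "0 < x" "x < 1" "gradient f (t + h) $ i - gradient f t $ i
      = hessian f (t + x *\<^sub>R h) $ i \<bullet> h"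
    by (auto simp: hessian_nth)
  have H: "\<bar>(hessian f (t + x *\<^sub>R h) $ i - hessian f t $ i) $ j\<bar> \<le> real CARD('d) * (G * e)" for j
  proof -
    have "(\<lambda>s. hessian f s $ i $ j) differentiable at (t + s *\<^sub>R h)" if "0 \<le> s" "s \<le> x" for s
      using that x by (intro C3_onD(3)[OF f] S) auto
    from line_mvt[OF x(1) this] obtain y where y: "0 < y" "y < x" "hessian f (t + x *\<^sub>R h) $ i $ j - hessian f t $ i $ j
        = x * (third_deriv f (t + y *\<^sub>R h) $ i $ j \<bullet> h)"
      by (auto simp: third_deriv_nth)
    have "\<bar>third_deriv f (t + y *\<^sub>R h) $ i $ j \<bullet> h\<bar> \<le> real CARD('d) * (G * e)"
      using G y x e by (intro abs_inner_le_entries) auto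
    moreover have "\<bar>x * (third_deriv f (t + y *\<^sub>R h) $ i $ j \<bullet> h)\<bar> \<le> \<bar>third_deriv f (t + y *\<^sub>R h) $ i $ j \<bullet> h\<bar>"
      using x by (simp add: abs_mult mult_left_le_one_le)
    ultimately show ?thesis using y(3) by simp
  qed
  have "\<bar>(hessian f (t + x *\<^sub>R h) $ i - hessian f t $ i) \<bullet> h\<bar> \<le> real CARD('d) * (real CARD('d) * (G * e) * e)"
    by (intro abs_inner_le_entries H e)
  then show ?thesis using x(3) by (simp add: inner_diff_left power2_eq_square mult_ac)
qed

text \<open>A partial derivative is a pointwise limit of difference quotients along a sequence that
  does not depend on \<open>x\<close>. Used three times in a row, this yields the measurability of
  all derivatives up to order three from that of the densities.\<close>

lemma borel_measurable_gradient:
  fixes F :: "'x \<Rightarrow> real^'d::finite \<Rightarrow> real"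
  assumes S: "open S" "t \<in> S"
    and meas: "\<And>s. s \<in> S \<Longrightarrow> (\<lambda>x. F x s) \<in> borel_measurable M"
    and diff: "\<And>x. x \<in> space M \<Longrightarrow> F x differentiable (at t)"
  shows "(\<lambda>x. gradient (F x) t $ i) \<in> borel_measurable M"
proof -
  let ?s = "\<lambda>n. t + (1 / real (Suc n)) *\<^sub>R axis i 1"
  have "(\<lambda>n. t + (1 / real (Suc n)) *\<^sub>R (axis i 1 :: real^'d)) \<longlonglongrightarrow> t + 0 *\<^sub>R axis i 1"
    by (intro tendsto_intros LIMSEQ_Suc lim_1_over_n)
  then have "\<forall>\<^sub>F n in sequentially. ?s n \<in> S"
    using S by (auto intro: topological_tendstoD)
  \<comment> \<open>Only late points of the sequence are known to lie in \<open>S\<close>, so the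
    quotients start at index \<open>k\<close>.\<close>
  then obtain k where k: "\<And>n. ?s (n + k) \<in> S"
    unfolding eventually_sequentially by (metis le_add2)
  show ?thesis
  proof (rule borel_measurable_LIMSEQ_real)
    show "(\<lambda>x. (F x (?s (n + k)) - F x t) / (1 / real (Suc (n + k)))) \<in> borel_measurable M" for n
      using meas[OF k] meas[OF S(2)] by measurable
    fix x assume "x \<in> space M"
    from line_has_real_derivative[of "F x" t 0 "axis i 1" UNIV] diff[OF this]
    have "((\<lambda>s. F x (t + s *\<^sub>R axis i 1)) has_real_derivative gradient (F x) t $ i) (at 0)"
      by (simp add: inner_axis)
    then have "((\<lambda>s. (F x (t + s *\<^sub>R axis i 1) - F x t) / s) \<longlongrightarrow> gradient (F x) t $ i) (at 0)"
      by (simp add: has_field_derivative_iff)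
    moreover have "filterlim (\<lambda>n. 1 / real (Suc n)) (at 0) sequentially"
      by (auto simp: filterlim_at intro!: LIMSEQ_Suc lim_1_over_n simp del: of_nat_Suc)
    ultimately have "(\<lambda>n. (F x (?s n) - F x t) / (1 / real (Suc n))) \<longlonglongrightarrow> gradient (F x) t $ i"
      by (rule filterlim_compose)
    then show "(\<lambda>n. (F x (?s (n + k)) - F x t) / (1 / real (Suc (n + k)))) \<longlonglongrightarrow> gradient (F x) t $ i"
      by (rule LIMSEQ_ignore_initial_segment)
  qed
qed

subsection \<open>Independent samples and normal tails\<close>

lemma iid_indep_vars:
  assumes P: "prob_space P" and X: "X \<in> P \<rightarrow>\<^sub>M N" and I: "finite I" "I \<noteq> {}"
  shows "prob_space.indep_vars (\<Pi>\<^sub>M i\<in>I. P) (\<lambda>_. N) (\<lambda>i xs. X (xs i)) I"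
proof -
  interpret Q: prob_space "\<Pi>\<^sub>M i\<in>I. P" using P by (rule prob_space_PiM)
  \<comment> \<open>Points of the product space are extensional, so restricting them to
    \<open>I\<close> changes nothing.\<close>
  have "distr (\<Pi>\<^sub>M i\<in>I. P) (\<Pi>\<^sub>M i\<in>I. P) (\<lambda>x. \<lambda>i\<in>I. x i) = distr (\<Pi>\<^sub>M i\<in>I. P) (\<Pi>\<^sub>M i\<in>I. P) (\<lambda>x. x)"
    by (intro distr_cong) (auto simp: space_PiM)
  also have "\<dots> = (\<Pi>\<^sub>M i\<in>I. P)" by simp
  also have "\<dots> = (\<Pi>\<^sub>M i\<in>I. distr (\<Pi>\<^sub>M i\<in>I. P) P (\<lambda>x. x i))"
    using P by (intro PiM_cong distr_PiM_component[symmetric]) auto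
  finally have "Q.indep_vars (\<lambda>_. P) (\<lambda>i x. x i) I"
    using I by (subst Q.indep_vars_iff_distr_eq_PiM') auto
  then show ?thesis
    by (rule Q.indep_vars_compose2) (use X in auto)
qed

lemma distr_iid_component:
  assumes "prob_space P" "X \<in> P \<rightarrow>\<^sub>M N" "i \<in> I"
  shows "distr (\<Pi>\<^sub>M i\<in>I. P) N (\<lambda>xs. X (xs i)) = distr P N X"
proof -
  have "distr (\<Pi>\<^sub>M i\<in>I. P) N (\<lambda>xs. X (xs i)) = distr (distr (\<Pi>\<^sub>M i\<in>I. P) P (\<lambda>xs. xs i)) N X"
    using assms by (subst distr_distr) (auto simp: comp_def)
  also have "distr (\<Pi>\<^sub>M i\<in>I. P) P (\<lambda>xs. xs i) = P"
    using assms by (intro distr_PiM_component)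
  finally show ?thesis .
qed

lemma nn_integral_iid_component:
  fixes u :: "'x \<Rightarrow> ennreal"
  assumes "prob_space P" "u \<in> borel_measurable P" "i \<in> I"
  shows "(\<integral>\<^sup>+xs. u (xs i) \<partial>(\<Pi>\<^sub>M i\<in>I. P)) = (\<integral>\<^sup>+x. u x \<partial>P)"
proof -
  have "(\<integral>\<^sup>+x. u x \<partial>P) = (\<integral>\<^sup>+x. u x \<partial>distr (\<Pi>\<^sub>M i\<in>I. P) P (\<lambda>xs. xs i))"
    using assms by (subst distr_PiM_component) auto
  also have "\<dots> = (\<integral>\<^sup>+xs. u (xs i) \<partial>(\<Pi>\<^sub>M i\<in>I. P))"
    using assms by (intro nn_integral_distr) auto
  finally show ?thesis ..
qed

lemma has_bochner_integral_iid_component: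
  fixes X :: "'x \<Rightarrow> real"
  assumes "prob_space P" "integrable P X" "i \<in> I"
  shows "integrable (\<Pi>\<^sub>M i\<in>I. P) (\<lambda>xs. X (xs i))"
    "(\<integral>xs. X (xs i) \<partial>(\<Pi>\<^sub>M i\<in>I. P)) = (\<integral>x. X x \<partial>P)"
proof -
  have [measurable]: "X \<in> borel_measurable P" using assms by auto
  have *: "distr (\<Pi>\<^sub>M i\<in>I. P) P (\<lambda>xs. xs i) = P"
    using assms by (intro distr_PiM_component)
  have [measurable]: "(\<lambda>xs. xs i) \<in> (\<Pi>\<^sub>M i\<in>I. P) \<rightarrow>\<^sub>M P" using assms by auto
  have "integrable (distr (\<Pi>\<^sub>M i\<in>I. P) P (\<lambda>xs. xs i)) X" unfolding * by fact
  then show "integrable (\<Pi>\<^sub>M i\<in>I. P) (\<lambda>xs. X (xs i))"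
    by (subst (asm) integrable_distr_eq) auto
  have "(\<integral>x. X x \<partial>P) = (\<integral>x. X x \<partial>distr (\<Pi>\<^sub>M i\<in>I. P) P (\<lambda>xs. xs i))" unfolding * ..
  also have "\<dots> = (\<integral>xs. X (xs i) \<partial>(\<Pi>\<^sub>M i\<in>I. P))" by (intro integral_distr) auto
  finally show "(\<integral>xs. X (xs i) \<partial>(\<Pi>\<^sub>M i\<in>I. P)) = (\<integral>x. X x \<partial>P)" ..
qed

lemma iid_second_moment:
  fixes X :: "'x \<Rightarrow> real"
  assumes P: "prob_space P" and X: "integrable P X" "integrable P (\<lambda>x. (X x)\<^sup>2)" "(\<integral>x. X x \<partial>P) = 0"
    and M: "1 \<le> M"
  shows "integrable (\<Pi>\<^sub>M i\<in>{..<M}. P) (\<lambda>xs. (\<Sum>i<M. X (xs i))\<^sup>2)"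
    "(\<integral>xs. (\<Sum>i<M. X (xs i))\<^sup>2 \<partial>(\<Pi>\<^sub>M i\<in>{..<M}. P)) = real M * (\<integral>x. (X x)\<^sup>2 \<partial>P)"
proof -
  let ?Q = "\<Pi>\<^sub>M i\<in>{..<M}. P"
  interpret Q: prob_space ?Q using P by (rule prob_space_PiM)
  have ind: "Q.indep_vars (\<lambda>_. borel) (\<lambda>i xs. X (xs i)) {..<M}"
    using P X M by (intro iid_indep_vars) (auto simp: lessThan_empty_iff)
  have cross: "integrable ?Q (\<lambda>xs. X (xs i) * X (xs j)) \<and>
      (\<integral>xs. X (xs i) * X (xs j) \<partial>?Q) = (if i = j then \<integral>x. (X x)\<^sup>2 \<partial>P else 0)"
    if "i < M" "j < M" for i j
  proof (cases "i = j")
    case True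
    then show ?thesis
      using has_bochner_integral_iid_component[OF P X(2), of i "{..<M}"] that
      by (simp add: power2_eq_square)
  next
    case False
    \<comment> \<open>The sum over the singleton \<open>{j}\<close> extracts independence of a pair
      from independence of the family.\<close>
    have "Q.indep_var borel (\<lambda>xs. X (xs i)) borel (\<lambda>xs. \<Sum>k\<in>{j}. X (xs k))"
      using False that by (intro Q.indep_vars_sum Q.indep_vars_subset[OF ind]) auto
    then have "Q.indep_var borel (\<lambda>xs. X (xs i)) borel (\<lambda>xs. X (xs j))" by simp
    then show ?thesis
      using has_bochner_integral_iid_component[OF P X(1), of i "{..<M}"]
        has_bochner_integral_iid_component[OF P X(1), of j "{..<M}"] X(3) that False
      by (simp add: Q.indep_var_lebesgue_integral Q.indep_var_integrable)
  qed
  have sq: "(\<lambda>xs. (\<Sum>i<M. X (xs i))\<^sup>2) = (\<lambda>xs. \<Sum>i<M. \<Sum>j<M. X (xs i) * X (xs j))"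
    by (simp add: power2_eq_square sum_product)
  show "integrable ?Q (\<lambda>xs. (\<Sum>i<M. X (xs i))\<^sup>2)"
    unfolding sq using cross by (intro Bochner_Integration.integrable_sum) auto
  have "(\<integral>xs. (\<Sum>i<M. X (xs i))\<^sup>2 \<partial>?Q) = (\<Sum>i<M. \<Sum>j<M. if i = j then \<integral>x. (X x)\<^sup>2 \<partial>P else 0)"
  proof -
    have "(\<integral>xs. (\<Sum>i<M. X (xs i))\<^sup>2 \<partial>?Q) = (\<Sum>i<M. \<integral>xs. (\<Sum>j<M. X (xs i) * X (xs j)) \<partial>?Q)"
      unfolding sq using cross by (intro Bochner_Integration.integral_sum Bochner_Integration.integrable_sum) auto
    also have "\<dots> = (\<Sum>i<M. \<Sum>j<M. \<integral>xs. X (xs i) * X (xs j) \<partial>?Q)"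
      using cross by (intro sum.cong refl Bochner_Integration.integral_sum) auto
    also have "\<dots> = (\<Sum>i<M. \<Sum>j<M. if i = j then \<integral>x. (X x)\<^sup>2 \<partial>P else 0)"
      using cross by (intro sum.cong refl) auto
    finally show ?thesis .
  qed
  then show "(\<integral>xs. (\<Sum>i<M. X (xs i))\<^sup>2 \<partial>?Q) = real M * (\<integral>x. (X x)\<^sup>2 \<partial>P)"
    by simp
qed

lemma iid_chebyshev:
  fixes X :: "'x \<Rightarrow> real"
  assumes P: "prob_space P" and X: "integrable P X" "integrable P (\<lambda>x. (X x)\<^sup>2)" "(\<integral>x. X x \<partial>P) = 0"
    and M: "1 \<le> M" and a: "0 < a"
  shows "measure (\<Pi>\<^sub>M i\<in>{..<M}. P) {xs \<in> space (\<Pi>\<^sub>M i\<in>{..<M}. P). real M * a \<le> \<bar>\<Sum>i<M. X (xs i)\<bar>}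
    \<le> (\<integral>x. (X x)\<^sup>2 \<partial>P) / (real M * a\<^sup>2)"
proof -
  let ?Q = "\<Pi>\<^sub>M i\<in>{..<M}. P"
  interpret Q: prob_space ?Q using P by (rule prob_space_PiM)
  have [measurable]: "X \<in> borel_measurable P" using X by auto
  have "measure ?Q {xs \<in> space ?Q. real M * a \<le> \<bar>\<Sum>i<M. X (xs i)\<bar>}
      \<le> (\<integral>xs. (\<Sum>i<M. X (xs i))\<^sup>2 \<partial>?Q) / (real M * a)\<^sup>2"
    using iid_second_moment(1)[OF P X M] a M by (intro Q.second_moment_method) auto
  also have "\<dots> = (\<integral>x. (X x)\<^sup>2 \<partial>P) / (real M * a\<^sup>2)"
    unfolding iid_second_moment(2)[OF P X M] using M a by (simp add: power2_eq_square)
  finally show ?thesis .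
qed

text \<open>Stated in \<open>ennreal\<close> for the envelope of the third derivatives, whose
  finiteness at an outcome is not presupposed but follows outside the event bounded here.\<close>

lemma iid_markov:
  fixes u :: "'x \<Rightarrow> ennreal"
  assumes P: "prob_space P" and u: "u \<in> borel_measurable P" "(\<integral>\<^sup>+x. u x \<partial>P) \<le> ennreal C"
    and M: "1 \<le> M" and K: "0 < K" and C: "0 \<le> C"
  shows "measure (\<Pi>\<^sub>M i\<in>{..<M}. P) {xs \<in> space (\<Pi>\<^sub>M i\<in>{..<M}. P). ennreal (real M * K) \<le> (\<Sum>i<M. u (xs i))}
    \<le> C / K"
proof -
  let ?Q = "\<Pi>\<^sub>M i\<in>{..<M}. P"
  interpret Q: prob_space ?Q using P by (rule prob_space_PiM)
  note [measurable] = u(1)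
  have pos: "0 < real M * K" using M K by simp
  \<comment> \<open>\<open>nn_integral_Markov_inequality\<close> has threshold 1, so the event is
    rescaled by \<open>1 / (real M * K)\<close>.\<close>
  have eq: "{xs \<in> space ?Q. ennreal (real M * K) \<le> (\<Sum>i<M. u (xs i))}
      = {xs \<in> space ?Q. 1 \<le> ennreal (1 / (real M * K)) * (\<Sum>i<M. u (xs i))}"
  proof (intro Collect_cong conj_cong refl)
    fix xs
    let ?s = "\<Sum>i<M. u (xs i)"
    have one: "ennreal (real M * K) * ennreal (1 / (real M * K)) = 1"
      using M K by (simp flip: ennreal_mult')
    show "ennreal (real M * K) \<le> ?s \<longleftrightarrow> 1 \<le> ennreal (1 / (real M * K)) * ?s"
    proof
      assume "ennreal (real M * K) \<le> ?s"
      then have "ennreal (1 / (real M * K)) * ennreal (real M * K) \<le> ennreal (1 / (real M * K)) * ?s"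
        by (rule mult_left_mono) simp
      then show "1 \<le> ennreal (1 / (real M * K)) * ?s"
        unfolding mult.commute[of "ennreal (1 / (real M * K))" "ennreal (real M * K)"] one .
    next
      assume "1 \<le> ennreal (1 / (real M * K)) * ?s"
      then have "ennreal (real M * K) * 1 \<le> ennreal (real M * K) * (ennreal (1 / (real M * K)) * ?s)"
        by (rule mult_left_mono) simp
      also have "\<dots> = (ennreal (real M * K) * ennreal (1 / (real M * K))) * ?s"
        by (rule mult.assoc[symmetric])
      finally show "ennreal (real M * K) \<le> ?s" unfolding one by simp
    qed
  qed
  have "emeasure ?Q {xs \<in> space ?Q. 1 \<le> ennreal (1 / (real M * K)) * (\<Sum>i<M. u (xs i))}
      \<le> ennreal (1 / (real M * K)) * (\<integral>\<^sup>+xs. (\<Sum>i<M. u (xs i)) * indicator (space ?Q) xs \<partial>?Q)"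
    by (intro nn_integral_Markov_inequality) auto
  also have "(\<integral>\<^sup>+xs. (\<Sum>i<M. u (xs i)) * indicator (space ?Q) xs \<partial>?Q) = (\<integral>\<^sup>+xs. (\<Sum>i<M. u (xs i)) \<partial>?Q)"
    by (intro nn_integral_cong) simp
  also have "\<dots> = (\<Sum>i<M. \<integral>\<^sup>+x. u x \<partial>P)"
    using P by (subst nn_integral_sum) (auto simp: nn_integral_iid_component)
  also have "ennreal (1 / (real M * K)) * \<dots> \<le> ennreal (1 / (real M * K)) * (\<Sum>i<M. ennreal C)"
    using u(2) by (intro mult_left_mono sum_mono) auto
  also have "\<dots> = ennreal (C / K)"
    using M K C by (simp add: ennreal_of_nat_eq_real_of_nat flip: ennreal_mult)
  finally show ?thesis
    unfolding eq Q.emeasure_eq_measure using C K by (simp add: ennreal_le_iff)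
qed

text \<open>Mills ratio bound: for x \<ge> t the density is at most x / t times itself, and x times
  the density is the derivative of minus the density. One half-line is open and the other closed
  because these are the pieces left over by a difference of distribution functions at t and
  -t.\<close>

lemma std_normal_upper_tail:
  assumes t: "0 < t"
  shows "measure std_normal_distribution {t<..} \<le> std_normal_density t / t"
    "measure std_normal_distribution {..-t} \<le> std_normal_density t / t"
proof -
  interpret N: real_distribution std_normal_distribution by (rule real_dist_normal_dist)
  have tail: "(\<integral>\<^sup>+x. ennreal (x * std_normal_density x) * indicator {t..} x \<partial>lborel)
      = ennreal (0 - (- std_normal_density t))"
  proof (rule nn_integral_FTC_atLeast)
    show "DERIV (\<lambda>x. - std_normal_density x) x :> x * std_normal_density x" for x
      unfolding std_normal_density_def
      by (auto intro!: derivative_eq_intros simp: field_simps power2_eq_square)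
    show "((\<lambda>x. - std_normal_density x) \<longlongrightarrow> 0) at_top"
      unfolding std_normal_density_def by real_asymp
  qed (use t in auto)
  have le: "(\<integral>\<^sup>+x. ennreal (std_normal_density x) * indicator {t..} x \<partial>lborel) \<le> ennreal (std_normal_density t / t)"
  proof -
    have "(\<integral>\<^sup>+x. ennreal (std_normal_density x) * indicator {t..} x \<partial>lborel)
        \<le> (\<integral>\<^sup>+x. ennreal (1/t) * (ennreal (x * std_normal_density x) * indicator {t..} x) \<partial>lborel)"
    proof (intro nn_integral_mono)
      fix x
      have "std_normal_density x \<le> 1 / t * (x * std_normal_density x)" if "t \<le> x"
        using that t mult_right_mono[of 1 "x/t" "std_normal_density x"] by simp
      then show "ennreal (std_normal_density x) * indicator {t..} x
          \<le> ennreal (1/t) * (ennreal (x * std_normal_density x) * indicator {t..} x)"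
        using t by (auto simp: indicator_def ennreal_leI simp flip: ennreal_mult'')
    qed
    also have "\<dots> = ennreal (1/t) * ennreal (std_normal_density t)"
      using tail by (subst nn_integral_cmult) auto
    also have "\<dots> = ennreal (std_normal_density t / t)"
      using t by (simp flip: ennreal_mult')
    finally show ?thesis .
  qed
  have "emeasure std_normal_distribution {t<..} = (\<integral>\<^sup>+x. ennreal (std_normal_density x) * indicator {t<..} x \<partial>lborel)"
    by (simp add: emeasure_density)
  also have "\<dots> \<le> (\<integral>\<^sup>+x. ennreal (std_normal_density x) * indicator {t..} x \<partial>lborel)"
    by (intro nn_integral_mono) (auto simp: indicator_def)
  also note le
  finally show "measure std_normal_distribution {t<..} \<le> std_normal_density t / t"
    using t unfolding N.emeasure_eq_measure by (simp add: ennreal_le_iff)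
  have "emeasure std_normal_distribution {..-t} = (\<integral>\<^sup>+x. ennreal (std_normal_density x) * indicator {..-t} x \<partial>lborel)"
    by (simp add: emeasure_density)
  also have "\<dots> = (\<integral>\<^sup>+x. ennreal (std_normal_density x) * indicator {t..} x \<partial>lborel)"
  proof -
    have "indicator {..-t} (- x) = (indicator {t..} x :: ennreal)" for x
      by (simp add: indicator_def)
    moreover have "std_normal_density (- x) = std_normal_density x" for x
      by (simp add: std_normal_density_def)
    moreover have "(\<lambda>x. ennreal (std_normal_density x) * indicator {..-t} x) \<in> borel_measurable borel"
      by measurable
    ultimately show ?thesis
      using nn_integral_real_affine[of "\<lambda>x. ennreal (std_normal_density x) * indicator {..-t} x" "-1" 0]
      by simp
  qed
  also note le
  finally show "measure std_normal_distribution {..-t} \<le> std_normal_density t / t"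
    using t unfolding N.emeasure_eq_measure by (simp add: ennreal_le_iff)
qed

subsection \<open>A uniform central limit theorem\<close>

text \<open>For numbers a, b in the unit disc, a^M and b^M differ by at most M |a - b|. Here a is
  the characteristic function of one summand at t / sqrt M and b is its second order Taylor
  polynomial; the third moment bounds |a - b| by a multiple of M^(-3/2). The condition
  \<open>t\<^sup>2 / 4 \<le> real M\<close> is what puts b into [-1, 1].\<close>

lemma iid_char_approx:
  fixes X :: "'x \<Rightarrow> real"
  assumes P: "prob_space P" and X: "X \<in> borel_measurable P"
    and moment3: "integrable P (\<lambda>x. \<bar>X x\<bar> ^ 3)" "(\<integral>x. \<bar>X x\<bar> ^ 3 \<partial>P) \<le> C"
    and moment2: "integrable P X" "integrable P (\<lambda>x. (X x)\<^sup>2)" "(\<integral>x. X x \<partial>P) = 0" "(\<integral>x. (X x)\<^sup>2 \<partial>P) = 1"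
    and M: "1 \<le> M" "t\<^sup>2 / 4 \<le> real M"
  shows "cmod (char (distr (\<Pi>\<^sub>M i\<in>{..<M}. P) borel (\<lambda>xs. (\<Sum>i<M. X (xs i)) / sqrt (real M))) t
      - of_real ((1 + (- (t\<^sup>2) / 2) / real M) ^ M)) \<le> \<bar>t\<bar> ^ 3 * C / 6 / sqrt (real M)"
proof -
  let ?Q = "\<Pi>\<^sub>M i\<in>{..<M}. P"
  interpret P: prob_space P by fact
  interpret Q: prob_space ?Q using P by (rule prob_space_PiM)
  note [measurable] = X
  have rt: "0 < sqrt (real M)" using M by simp
  let ?s = "t / sqrt (real M)"
  let ?\<mu> = "distr P borel X"
  interpret \<mu>: real_distribution ?\<mu> by (rule P.real_distribution_distr) fact
  have "Q.indep_vars (\<lambda>_. borel) (\<lambda>i xs. X (xs i) / sqrt (real M)) {..<M}"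
    using P X M by (intro iid_indep_vars) (auto simp: lessThan_empty_iff)
  from Q.char_distr_sum[OF this, of t]
  have "char (distr ?Q borel (\<lambda>xs. (\<Sum>i<M. X (xs i)) / sqrt (real M))) t
      = (\<Prod>i<M. char (distr ?Q borel (\<lambda>xs. X (xs i) / sqrt (real M))) t)"
    by (simp add: sum_divide_distrib)
  also have "\<dots> = (\<Prod>i<M. char ?\<mu> ?s)"
  proof (intro prod.cong refl)
    fix i assume "i \<in> {..<M}"
    then have "distr ?Q borel (\<lambda>xs. X (xs i) / sqrt (real M)) = distr P borel (\<lambda>x. X x / sqrt (real M))"
      using P by (intro distr_iid_component) auto
    then show "char (distr ?Q borel (\<lambda>xs. X (xs i) / sqrt (real M))) t = char ?\<mu> ?s"
      by (simp add: char_def integral_distr)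
  qed
  finally have char_eq: "char (distr ?Q borel (\<lambda>xs. (\<Sum>i<M. X (xs i)) / sqrt (real M))) t = char ?\<mu> ?s ^ M"
    by simp
  have "cmod (char ?\<mu> ?s - (1 - ?s\<^sup>2 * 1 / 2))
      \<le> ?s\<^sup>2 / 6 * (\<integral>x. min (6 * (X x)\<^sup>2) (\<bar>?s\<bar> * \<bar>X x\<bar> ^ 3) \<partial>P)"
    using moment2 by (intro P.char_approx3') auto
  also have "(\<integral>x. min (6 * (X x)\<^sup>2) (\<bar>?s\<bar> * \<bar>X x\<bar> ^ 3) \<partial>P) \<le> (\<integral>x. \<bar>?s\<bar> * \<bar>X x\<bar> ^ 3 \<partial>P)"
    using moment2 moment3 by (intro integral_mono integrable_min integrable_mult_right) auto
  also have "\<dots> = \<bar>?s\<bar> * (\<integral>x. \<bar>X x\<bar> ^ 3 \<partial>P)" by simp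
  also have "\<dots> \<le> \<bar>?s\<bar> * C" using moment3(2) by (intro mult_left_mono) auto
  finally have approx: "cmod (char ?\<mu> ?s - (1 - ?s\<^sup>2 * 1 / 2)) \<le> ?s\<^sup>2 / 6 * (\<bar>?s\<bar> * C)"
    by (simp add: mult_left_mono)
  have s2: "1 - ?s\<^sup>2 * 1 / 2 = 1 + (- (t\<^sup>2) / 2) / real M"
    using M by (simp add: power_divide)
  have "cmod (char ?\<mu> ?s ^ M - of_real (1 + (- (t\<^sup>2) / 2) / real M) ^ M)
      \<le> real M * cmod (char ?\<mu> ?s - of_real (1 + (- (t\<^sup>2) / 2) / real M))"
  proof (rule norm_power_diff)
    show "cmod (char ?\<mu> ?s) \<le> 1" by (rule \<mu>.cmod_char_le_1)
    have "t\<^sup>2 \<le> 4 * real M" using M by simp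
    then have "\<bar>1 + (- (t\<^sup>2) / 2) / real M\<bar> \<le> 1"
      using M by (auto simp: abs_le_iff field_simps)
    then show "cmod (of_real (1 + (- (t\<^sup>2) / 2) / real M)) \<le> 1" unfolding norm_of_real .
  qed
  also have "cmod (char ?\<mu> ?s - of_real (1 + (- (t\<^sup>2) / 2) / real M)) \<le> ?s\<^sup>2 / 6 * (\<bar>?s\<bar> * C)"
    using approx unfolding s2[symmetric] by simp
  also have "real M * (?s\<^sup>2 / 6 * (\<bar>?s\<bar> * C)) = \<bar>t\<bar> ^ 3 * C / 6 / sqrt (real M)"
    using M by (simp add: power_divide power3_eq_cube power2_eq_square abs_mult_self_eq)
  finally show ?thesis unfolding char_eq by (simp add: mult_left_mono)
qed

text \<open>Uniformity comes from arguing along sequences: a failing sequence of laws would still have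
  characteristic functions converging to the normal one, by the common third-moment bound.\<close>

lemma uniform_clt_tail:
  fixes C t \<eta> :: real
  assumes t: "0 < t" and \<eta>: "0 < \<eta>"
  shows "\<exists>M0\<ge>1. \<forall>M\<ge>M0. \<forall>(P :: 'x measure) X. prob_space P \<longrightarrow> X \<in> borel_measurable P \<longrightarrow>
    integrable P (\<lambda>x. \<bar>X x\<bar> ^ 3) \<longrightarrow> (\<integral>x. \<bar>X x\<bar> ^ 3 \<partial>P) \<le> C \<longrightarrow>
    integrable P X \<longrightarrow> integrable P (\<lambda>x. (X x)\<^sup>2) \<longrightarrow> (\<integral>x. X x \<partial>P) = 0 \<longrightarrow> (\<integral>x. (X x)\<^sup>2 \<partial>P) = 1 \<longrightarrow>
    measure (\<Pi>\<^sub>M i\<in>{..<M}. P) {xs \<in> space (\<Pi>\<^sub>M i\<in>{..<M}. P). t < \<bar>(\<Sum>i<M. X (xs i)) / sqrt (real M)\<bar>}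
      < 2 * (std_normal_density t / t) + \<eta>" (is ?claim)
proof (rule ccontr)
  let ?good = "\<lambda>(P :: 'x measure) X. prob_space P \<and> X \<in> borel_measurable P \<and>
    integrable P (\<lambda>x. \<bar>X x\<bar> ^ 3) \<and> (\<integral>x. \<bar>X x\<bar> ^ 3 \<partial>P) \<le> C \<and>
    integrable P X \<and> integrable P (\<lambda>x. (X x)\<^sup>2) \<and> (\<integral>x. X x \<partial>P) = 0 \<and> (\<integral>x. (X x)\<^sup>2 \<partial>P) = 1"
  let ?bad = "\<lambda>M (P :: 'x measure) X. \<not>
    measure (\<Pi>\<^sub>M i\<in>{..<M}. P) {xs \<in> space (\<Pi>\<^sub>M i\<in>{..<M}. P). t < \<bar>(\<Sum>i<M. X (xs i)) / sqrt (real M)\<bar>}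
      < 2 * (std_normal_density t / t) + \<eta>"
  assume neg: "\<not> ?thesis"
  \<comment> \<open>Asking for \<open>Suc n \<le> M\<close> drives the sample sizes of the
    counterexamples to infinity.\<close>
  have "\<exists>M P X. Suc n \<le> M \<and> ?good P X \<and> ?bad M P X" for n
  proof (rule ccontr)
    assume "\<not> (\<exists>M P X. Suc n \<le> M \<and> ?good P X \<and> ?bad M P X)"
    then have ?claim by (intro exI[of _ "Suc n"] conjI) (simp, blast)
    with neg show False by contradiction
  qed
  then have "\<forall>n. \<exists>z. Suc n \<le> fst z \<and> ?good (fst (snd z)) (snd (snd z)) \<and> ?bad (fst z) (fst (snd z)) (snd (snd z))"
    unfolding fst_conv snd_conv split_paired_Ex by (intro allI)
  from choice[OF this] obtain z where z: "\<forall>n. Suc n \<le> fst (z n) \<and>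
      ?good (fst (snd (z n))) (snd (snd (z n))) \<and> ?bad (fst (z n)) (fst (snd (z n))) (snd (snd (z n)))" ..
  define m where "m n = fst (z n)" for n
  define Ps where "Ps n = fst (snd (z n))" for n
  define Xs where "Xs n = snd (snd (z n))" for n
  have seq: "Suc n \<le> m n" "?good (Ps n) (Xs n)" "?bad (m n) (Ps n) (Xs n)" for n
    using z[rule_format, of n] unfolding m_def Ps_def Xs_def by (rule conjunct1, rule conjunct1[OF conjunct2], rule conjunct2[OF conjunct2])
  define Q where "Q n = (\<Pi>\<^sub>M i\<in>{..<m n}. Ps n)" for n
  define S where "S n xs = (\<Sum>i<m n. Xs n (xs i)) / sqrt (real (m n))" for n xs
  define D where "D n = distr (Q n) borel (S n)" for n
  have [measurable]: "Xs n \<in> borel_measurable (Ps n)" for n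
    using seq(2)[of n] by blast
  have [measurable]: "S n \<in> borel_measurable (Q n)" for n
    unfolding S_def Q_def by measurable
  have Q: "prob_space (Q n)" for n
    unfolding Q_def using seq(2) by (intro prob_space_PiM) auto
  have D: "real_distribution (D n)" for n
    unfolding D_def using Q by (intro prob_space.real_distribution_distr) auto
  interpret N: real_distribution std_normal_distribution by (rule real_dist_normal_dist)
  have m_lim: "filterlim (\<lambda>n. real (m n)) at_top sequentially"
  proof (rule filterlim_at_top_mono[OF filterlim_real_sequentially])
    show "\<forall>\<^sub>F n in sequentially. real n \<le> real (m n)"
      using seq(1) by (intro always_eventually) (auto intro: Suc_leD)
  qed
  \<comment> \<open>The law of the summands changes with \<open>n\<close>, so Levy's theorem is
    applied to the normalized sums themselves; the power they are compared with depends on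
    \<open>n\<close> only through \<open>m n\<close> and tends to the normal characteristic
    function.\<close>
  have conv: "weak_conv_m D std_normal_distribution"
  proof (rule levy_continuity[OF D real_dist_normal_dist])
    fix s :: real
    have ev: "\<forall>\<^sub>F n in sequentially. s\<^sup>2 / 4 \<le> real (m n)"
      using m_lim unfolding filterlim_at_top by blast
    have "\<forall>\<^sub>F n in sequentially. cmod (char (D n) s - of_real ((1 + (- (s\<^sup>2) / 2) / real (m n)) ^ m n))
        \<le> \<bar>s\<bar> ^ 3 * C / 6 / sqrt (real (m n))"
      using ev
    proof eventually_elim
      case (elim n)
      have "1 \<le> m n" using seq(1)[of n] by simp
      then show ?case
        unfolding D_def Q_def S_def using seq(2)[of n] elim by (intro iid_char_approx) auto
    qed
    moreover have "(\<lambda>n. \<bar>s\<bar> ^ 3 * C / 6 / sqrt (real (m n))) \<longlonglongrightarrow> 0"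
      by (intro tendsto_divide_0[OF tendsto_const] filterlim_at_top_imp_at_infinity
          filterlim_compose[OF sqrt_at_top m_lim])
    ultimately have diff: "(\<lambda>n. char (D n) s - of_real ((1 + (- (s\<^sup>2) / 2) / real (m n)) ^ m n)) \<longlonglongrightarrow> 0"
      by (rule Lim_null_comparison)
    have "filterlim m at_top sequentially"
      using m_lim by (simp add: filterlim_sequentially_iff_filterlim_real)
    then have "(\<lambda>n. (1 + (- (s\<^sup>2) / 2) / real (m n)) ^ m n) \<longlonglongrightarrow> exp (- (s\<^sup>2) / 2)"
      by (rule filterlim_compose[OF tendsto_exp_limit_sequentially])
    then have "(\<lambda>n. complex_of_real ((1 + (- (s\<^sup>2) / 2) / real (m n)) ^ m n)) \<longlonglongrightarrow> of_real (exp (- (s\<^sup>2) / 2))"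
      by (rule tendsto_of_real)
    from tendsto_add[OF diff this]
    show "(\<lambda>n. char (D n) s) \<longlonglongrightarrow> char std_normal_distribution s"
      by (simp add: char_std_normal_distribution)
  qed
  \<comment> \<open>The normal law has no atoms, so weak convergence gives convergence of the
    distribution functions at both \<open>t\<close> and \<open>-t\<close>.\<close>
  have cont: "isCont (cdf std_normal_distribution) x" for x
  proof -
    have "AE y in lborel. y \<noteq> x" using AE_lborel_singleton[of x] .
    then have "emeasure std_normal_distribution {x} = 0"
      by (subst emeasure_density) (auto simp: nn_integral_0_iff_AE indicator_def elim!: AE_mp)
    then show ?thesis unfolding N.isCont_cdf by (simp add: measure_def)
  qed
  have "(\<lambda>n. cdf (D n) t - cdf (D n) (-t)) \<longlonglongrightarrow> cdf std_normal_distribution t - cdf std_normal_distribution (-t)"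
    using conv cont unfolding weak_conv_m_def weak_conv_def by (intro tendsto_diff) auto
  moreover have "cdf std_normal_distribution t - cdf std_normal_distribution (-t) \<ge> 1 - 2 * (std_normal_density t / t)"
  proof -
    have "cdf std_normal_distribution t = 1 - measure std_normal_distribution {t<..}"
    proof -
      have "- {t<..} = {..t}" by auto
      then show ?thesis
        using N.prob_compl[of "{t<..}"] by (simp add: cdf_def Compl_eq_Diff_UNIV)
    qed
    then show ?thesis
      using std_normal_upper_tail[OF t] by (simp add: cdf_def)
  qed
  ultimately have "\<forall>\<^sub>F n in sequentially. cdf (D n) t - cdf (D n) (-t) > 1 - 2 * (std_normal_density t / t) - \<eta>"
    using \<eta> by (intro order_tendstoD(1)) auto
  then obtain n where n: "cdf (D n) t - cdf (D n) (-t) > 1 - 2 * (std_normal_density t / t) - \<eta>"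
    unfolding eventually_sequentially by blast
  interpret Dn: real_distribution "D n" by (rule D)
  have "measure (Q n) {xs \<in> space (Q n). t < \<bar>S n xs\<bar>} = measure (D n) {x. t < \<bar>x\<bar>}"
    unfolding D_def by (subst measure_distr) (auto intro!: arg_cong[where f="measure _"])
  \<comment> \<open>The half-open interval is the one whose measure is a difference of distribution
    functions; including the point \<open>-t\<close> in the tail only enlarges the bound.\<close>
  also have "\<dots> \<le> measure (D n) (space (D n) - {-t<..t})"
    by (intro Dn.finite_measure_mono) auto
  also have "\<dots> = 1 - (cdf (D n) t - cdf (D n) (-t))"
    using t by (subst Dn.prob_compl) (auto simp: Dn.cdf_diff_eq)
  finally show False
    using n seq(3)[of n] unfolding Q_def S_def by linarith
qed

subsection \<open>Stationary points from approximate linearity\<close>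

lemma infnorm_le_iff_entries:
  fixes v :: "real^'d::finite"
  shows "infnorm v \<le> e \<longleftrightarrow> (\<forall>k. \<bar>v $ k\<bar> \<le> e)"
proof
  assume "infnorm v \<le> e"
  then show "\<forall>k. \<bar>v $ k\<bar> \<le> e"
    using component_le_infnorm_cart order_trans by blast
next
  assume "\<forall>k. \<bar>v $ k\<bar> \<le> e"
  then show "infnorm v \<le> e"
    unfolding infnorm_cart by (intro cSup_least) auto
qed

text \<open>Since \<open>A ** F\<close> is the identity, \<open>D + A *v g D\<close> equals
  \<open>A *v g 0 + A *v (g D - g 0 + F *v D)\<close>. The first term uses up
  \<open>(1 - \<kappa>) * e\<close>, and \<open>small\<close> bounds the second by
  \<open>\<kappa> * e\<close>. Brouwer asks for continuity only, so no contraction estimate is made;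
  at a fixed point \<open>A *v g D = 0\<close>, and \<open>F\<close> cancels
  \<open>A\<close>.\<close>

lemma approximate_newton_zero:
  fixes g :: "real^'d::finite \<Rightarrow> real^'d" and A F H :: "real^'d^'d"
  assumes inv: "A ** F = mat 1" "F ** A = mat 1"
    and cont: "continuous_on {D. infnorm D \<le> e} g"
    and B: "\<And>a i. \<bar>A $ a $ i\<bar> \<le> B"
    and score: "\<And>a. \<bar>(A *v g 0) $ a\<bar> \<le> (1 - \<kappa>) * e"
    and hess: "\<And>i j. \<bar>H $ i $ j + F $ i $ j\<bar> \<le> \<eta>"
    and rem: "\<And>D i. infnorm D \<le> e \<Longrightarrow> \<bar>g D $ i - g 0 $ i - H $ i \<bullet> D\<bar> \<le> R"
    and small: "real CARD('d) * (B * (real CARD('d) * (\<eta> * e) + R)) \<le> \<kappa> * e"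
    and e: "0 \<le> e"
  shows "\<exists>D. infnorm D \<le> e \<and> g D = 0"
proof -
  let ?C = "{D :: real^'d. infnorm D \<le> e}"
  have C: "?C = cbox (\<chi> k. - e) (\<chi> k. e)"
    by (auto simp: infnorm_le_iff_entries mem_box_cart abs_le_iff minus_le_iff)
  let ?f = "\<lambda>D. D + A *v g D"
  have bound: "infnorm (?f D) \<le> e" if D: "infnorm D \<le> e" for D
    unfolding infnorm_le_iff_entries
  proof
    fix a
    let ?w = "g D - g 0 + F *v D"
    have w: "\<bar>?w $ i\<bar> \<le> real CARD('d) * (\<eta> * e) + R" for i
    proof -
      have "?w $ i = (g D $ i - g 0 $ i - H $ i \<bullet> D) + (H $ i + F $ i) \<bullet> D"
        by (simp add: matrix_vector_mul_component inner_add_left)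
      moreover have "\<bar>(H $ i + F $ i) \<bullet> D\<bar> \<le> real CARD('d) * (\<eta> * e)"
        using hess D by (intro abs_inner_le_entries) (auto simp: infnorm_le_iff_entries)
      ultimately show ?thesis using rem[OF D, of i] by linarith
    qed
    have "A *v (F *v D) = D" using inv by (simp add: matrix_vector_mul_assoc)
    then have "?f D = A *v g 0 + A *v ?w"
      by (simp add: matrix_vector_right_distrib matrix_vector_mult_diff_distrib)
    then have "?f D $ a = (A *v g 0) $ a + A $ a \<bullet> ?w"
      by (simp add: matrix_vector_mul_component)
    moreover have "\<bar>A $ a \<bullet> ?w\<bar> \<le> real CARD('d) * (B * (real CARD('d) * (\<eta> * e) + R))"
      using B w by (intro abs_inner_le_entries) auto
    ultimately show "\<bar>?f D $ a\<bar> \<le> e"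
      using score[of a] small by (simp add: algebra_simps)
  qed
  obtain D where "D \<in> ?C" "?f D = D"
  proof (rule brouwer)
    show "compact ?C" "convex ?C" unfolding C by (rule compact_cbox convex_box)+
    show "continuous_on ?C ?f"
      using cont by (intro continuous_intros
          bounded_linear.continuous_on[OF matrix_vector_mul_bounded_linear])
    show "?C \<noteq> {}" using e by (auto intro!: exI[of _ 0] simp: infnorm_0)
    show "?f \<in> ?C \<rightarrow> ?C" using bound by auto
  qed
  then have D: "infnorm D \<le> e" "A *v g D = 0" by auto
  then have "F *v (A *v g D) = 0" by simp
  then have "g D = 0" using inv by (simp add: matrix_vector_mul_assoc)
  with D show ?thesis by blast
qed

lemma norm_le_infnorm_bound:
  fixes v :: "real^'d::finite"
  assumes "infnorm v \<le> e"
  shows "norm v \<le> real CARD('d) * e"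
proof -
  have "norm v \<le> (\<Sum>k\<in>UNIV. \<bar>v $ k\<bar>)" by (rule norm_le_l1_cart)
  also have "\<dots> \<le> (\<Sum>k\<in>(UNIV::'d set). e)"
    using assms by (intro sum_mono) (auto simp: infnorm_le_iff_entries)
  finally show ?thesis by simp
qed

text \<open>The deterministic half of the argument. Its hypotheses are bounds on sums over the
  sample, each the complement of one exceptional event, and dividing by \<open>M\<close> turns them
  into those of \<open>approximate_newton_zero\<close>. The condition
  \<open>real CARD('d) * e \<le> r\<close> puts the cube into the Euclidean ball on which the third
  derivatives are controlled.\<close>

lemma stationary_point_in_cube:
  fixes f :: "nat \<Rightarrow> real^'d::finite \<Rightarrow> real" and A F :: "real^'d^'d"
  assumes f: "\<And>k. k < M \<Longrightarrow> C3_on S (f k)" and S: "open S" "\<And>D. norm D \<le> r \<Longrightarrow> \<theta> + D \<in> S"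
    and M: "1 \<le> M"
    and G: "\<And>k D i j l. k < M \<Longrightarrow> norm D \<le> r \<Longrightarrow> \<bar>third_deriv (f k) (\<theta> + D) $ i $ j $ l\<bar> \<le> G k"
    and inv: "A ** F = mat 1" "F ** A = mat 1"
    and B: "\<And>a i. \<bar>A $ a $ i\<bar> \<le> B"
    and score: "\<And>a. \<bar>\<Sum>k<M. (A *v gradient (f k) \<theta>) $ a\<bar> \<le> real M * ((1 - \<kappa>) * e)"
    and hess: "\<And>i j. \<bar>\<Sum>k<M. (hessian (f k) \<theta> $ i $ j + F $ i $ j)\<bar> \<le> real M * \<eta>"
    and third: "(\<Sum>k<M. G k) \<le> real M * K"
    and small: "real CARD('d) * (B * (real CARD('d) * (\<eta> * e) + (real CARD('d))\<^sup>2 * K * e\<^sup>2)) \<le> \<kappa> * e"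
    and e: "0 \<le> e" "real CARD('d) * e \<le> r"
  shows "\<exists>t\<in>S. infnorm (t - \<theta>) \<le> e \<and> gradient (\<lambda>t. \<Sum>k<M. f k t) t = 0"
proof -
  define g where "g D = (1 / real M) *\<^sub>R (\<Sum>k<M. gradient (f k) (\<theta> + D))" for D
  define H where "H = (1 / real M) *\<^sub>R (\<Sum>k<M. hessian (f k) \<theta>)"
  have M0: "0 < real M" using M by simp
  have nm: "norm D \<le> r" if "infnorm D \<le> e" for D :: "real^'d"
    using norm_le_infnorm_bound[OF that] e by linarith
  have "\<exists>D. infnorm D \<le> e \<and> g D = 0"
  proof (rule approximate_newton_zero[OF inv _ B])
    have "continuous_on {D. infnorm D \<le> e} (\<lambda>D. gradient (f k) (\<theta> + D))" if "k < M" for k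
    proof (rule continuous_on_compose2[of S "gradient (f k)"])
      show "continuous_on S (gradient (f k))"
        using f[OF that] by (auto simp: C3_on_def intro: differentiable_imp_continuous_on)
      show "(\<lambda>D. \<theta> + D) ` {D. infnorm D \<le> e} \<subseteq> S"
        using S nm by auto
    qed (intro continuous_intros)
    then show "continuous_on {D. infnorm D \<le> e} g"
      unfolding g_def by (intro continuous_intros) auto
    have "A *v (\<Sum>k\<in>I. v k) = (\<Sum>k\<in>I. A *v v k)" for I and v :: "nat \<Rightarrow> real^'d"
      by (rule linear_sum[OF matrix_vector_mul_linear])
    then have Ag: "A *v g 0 = (1 / real M) *\<^sub>R (\<Sum>k<M. A *v gradient (f k) \<theta>)"
      unfolding g_def by (simp add: matrix_vector_mult_scaleR)
    show "\<bar>(A *v g 0) $ a\<bar> \<le> (1 - \<kappa>) * e" for a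
      unfolding Ag using score[of a] M0 by (simp add: field_simps)
    show "\<bar>H $ i $ j + F $ i $ j\<bar> \<le> \<eta>" for i j
    proof -
      have "H $ i $ j + F $ i $ j = (\<Sum>k<M. (hessian (f k) \<theta> $ i $ j + F $ i $ j)) / real M"
        using M0 unfolding H_def by (simp add: sum.distrib field_simps)
      then show ?thesis
        using hess[of i j] M0 by (simp add: abs_divide pos_divide_le_eq mult.commute)
    qed
    fix D :: "real^'d" and i assume D: "infnorm D \<le> e"
    have "\<bar>gradient (f k) (\<theta> + D) $ i - gradient (f k) \<theta> $ i - hessian (f k) \<theta> $ i \<bullet> D\<bar>
        \<le> (real CARD('d))\<^sup>2 * G k * e\<^sup>2" if "k < M" for k
    proof (rule gradient_taylor[OF f[OF that] S(1)])
      have n: "norm (s *\<^sub>R D) \<le> r" if "0 \<le> s" "s \<le> 1" for s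
        using nm[OF D] that by (smt (verit) mult_left_le_one_le norm_ge_zero norm_scaleR)
      show "\<theta> + s *\<^sub>R D \<in> S" if "0 \<le> s" "s \<le> 1" for s
        using n[OF that] by (rule S(2))
      show "\<bar>third_deriv (f k) (\<theta> + s *\<^sub>R D) $ i $ j $ l\<bar> \<le> G k" if "0 \<le> s" "s \<le> 1" for s i j l
        using n[OF that] by (rule G[OF \<open>k < M\<close>])
      show "\<bar>D $ k\<bar> \<le> e" for k using D by (simp add: infnorm_le_iff_entries)
    qed
    then have "\<bar>\<Sum>k<M. gradient (f k) (\<theta> + D) $ i - gradient (f k) \<theta> $ i - hessian (f k) \<theta> $ i \<bullet> D\<bar>
        \<le> (\<Sum>k<M. (real CARD('d))\<^sup>2 * G k * e\<^sup>2)"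
      by (intro order_trans[OF sum_abs] sum_mono) auto
    also have "\<dots> = (real CARD('d))\<^sup>2 * e\<^sup>2 * (\<Sum>k<M. G k)"
      unfolding sum_distrib_left by (intro sum.cong refl) (simp add: mult_ac)
    also have "\<dots> \<le> (real CARD('d))\<^sup>2 * e\<^sup>2 * (real M * K)"
      using third by (intro mult_left_mono) auto
    finally have le: "\<bar>\<Sum>k<M. gradient (f k) (\<theta> + D) $ i - gradient (f k) \<theta> $ i - hessian (f k) \<theta> $ i \<bullet> D\<bar>
        \<le> real M * ((real CARD('d))\<^sup>2 * K * e\<^sup>2)" by (simp add: mult_ac)
    have "g D $ i - g 0 $ i - H $ i \<bullet> D
        = (\<Sum>k<M. gradient (f k) (\<theta> + D) $ i - gradient (f k) \<theta> $ i - hessian (f k) \<theta> $ i \<bullet> D) / real M"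
      unfolding g_def H_def by (simp add: sum_subtractf inner_sum_left diff_divide_distrib)
    then show "\<bar>g D $ i - g 0 $ i - H $ i \<bullet> D\<bar> \<le> (real CARD('d))\<^sup>2 * K * e\<^sup>2"
      using le M0 by (simp only: abs_divide abs_of_pos pos_divide_le_eq) (simp only: mult_ac)
  qed (use small e in auto)
  then obtain D where D: "infnorm D \<le> e" "g D = 0" by blast
  have inS: "\<theta> + D \<in> S" using nm[OF D(1)] by (rule S(2))
  have "gradient (\<lambda>t. \<Sum>k<M. f k t) (\<theta> + D) = (\<Sum>k<M. gradient (f k) (\<theta> + D))"
    using C3_onD(1)[OF f S(1) inS] by (intro gradient_sum) auto
  also have "\<dots> = 0" using D(2) M0 by (simp add: g_def)
  finally show ?thesis using inS D(1) by (intro bexI[of _ "\<theta> + D"]) auto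
qed

text \<open>The set of samples with a zero in a given set is thereby a countable combination of events.\<close>

lemma exists_zero_iff_dense:
  fixes f :: "'a::metric_space \<Rightarrow> 'b::real_normed_vector"
  assumes K: "compact K" and T: "T \<subseteq> K" "K \<subseteq> closure T" and f: "continuous_on K f"
  shows "(\<exists>t\<in>K. f t = 0) \<longleftrightarrow> (\<forall>m. \<exists>t\<in>T. norm (f t) < 1 / real (Suc m))"
proof
  assume "\<exists>t\<in>K. f t = 0"
  then obtain t where t: "t \<in> K" "f t = 0" by blast
  show "\<forall>m. \<exists>t\<in>T. norm (f t) < 1 / real (Suc m)"
  proof
    fix m
    have "0 < 1 / real (Suc m)" by simp
    with f t obtain r where r: "0 < r" "\<And>s. s \<in> K \<Longrightarrow> dist s t < r \<Longrightarrow> dist (f s) (f t) < 1 / real (Suc m)"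
      unfolding continuous_on_iff by meson
    obtain s where "s \<in> T" "dist s t < r"
      using T t r(1) closure_approachable by blast
    with r T t(2) show "\<exists>t\<in>T. norm (f t) < 1 / real (Suc m)" by (auto intro!: bexI[of _ s] simp: dist_norm)
  qed
next
  assume *: "\<forall>m. \<exists>t\<in>T. norm (f t) < 1 / real (Suc m)"
  then have "K \<noteq> {}" using T by blast
  \<comment> \<open>By compactness the norm attains its minimum, and a positive minimum would
    exclude values below \<open>1 / real (Suc m)\<close> for large \<open>m\<close>.\<close>
  have "continuous_on K (\<lambda>t. norm (f t))" using f by (intro continuous_intros)
  from continuous_attains_inf[OF K \<open>K \<noteq> {}\<close> this]
  obtain s where s: "s \<in> K" "\<And>t. t \<in> K \<Longrightarrow> norm (f s) \<le> norm (f t)" by blast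
  have "f s = 0"
  proof (rule ccontr)
    assume "f s \<noteq> 0"
    then obtain m where "1 / real (Suc m) < norm (f s)"
      by (metis nat_approx_posE zero_less_norm_iff)
    moreover from * obtain t where "t \<in> T" "norm (f t) < 1 / real (Suc m)" by blast
    ultimately show False using s(2)[of t] T by auto
  qed
  then show "\<exists>t\<in>K. f t = 0" using s(1) by blast
qed

text \<open>An open set is a countable union of compact sets, and these stay compact after
  intersection with \<open>C\<close>. On each of them a countable dense set decides whether there is
  a zero, so no zero has to be selected measurably.\<close>

lemma measurable_exists_zero:
  fixes f :: "'x \<Rightarrow> 'a::euclidean_space \<Rightarrow> 'b::real_normed_vector"
  assumes S: "open S" and C: "closed C"
    and meas: "\<And>t. t \<in> S \<Longrightarrow> (\<lambda>x. norm (f x t)) \<in> borel_measurable M"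
    and cont: "\<And>x. x \<in> space M \<Longrightarrow> continuous_on S (f x)"
  shows "{x \<in> space M. \<exists>t\<in>S. t \<in> C \<and> f x t = 0} \<in> sets M"
proof -
  obtain U where U: "\<And>n. compact (U n)" "\<And>n. U n \<subseteq> S" "\<And>n. U n \<subseteq> interior (U (Suc n))"
    "\<Union>(range U) = S" "\<And>K. compact K \<Longrightarrow> K \<subseteq> S \<Longrightarrow> \<exists>N. \<forall>n\<ge>N. K \<subseteq> U n"
    by (rule open_Union_compact_subsets[OF S], rule that)
  define K where "K n = U n \<inter> C" for n :: nat
  have K: "compact (K n)" "K n \<subseteq> S" for n
    using U C by (auto simp: K_def)
  have "\<exists>T. countable T \<and> T \<subseteq> K n \<and> K n \<subseteq> closure T" for n
    using separable[of "K n"] by metis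
  then obtain T where T: "\<And>n. countable (T n)" "\<And>n. T n \<subseteq> K n" "\<And>n. K n \<subseteq> closure (T n)"
    by metis
  have "(\<exists>t\<in>S. t \<in> C \<and> f x t = 0) \<longleftrightarrow> (\<exists>n. \<forall>m. \<exists>t\<in>T n. norm (f x t) < 1 / real (Suc m))"
    if "x \<in> space M" for x
  proof -
    have "(\<exists>t\<in>S. t \<in> C \<and> f x t = 0) \<longleftrightarrow> (\<exists>n. \<exists>t\<in>K n. f x t = 0)"
      unfolding K_def U(4)[symmetric] by blast
    also have "\<dots> \<longleftrightarrow> (\<exists>n. \<forall>m. \<exists>t\<in>T n. norm (f x t) < 1 / real (Suc m))"
      using K T cont[OF that] by (intro ex_cong1 exists_zero_iff_dense) (auto intro: continuous_on_subset)
    finally show ?thesis .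
  qed
  then have "{x \<in> space M. \<exists>t\<in>S. t \<in> C \<and> f x t = 0}
      = {x \<in> space M. \<exists>n. \<forall>m. \<exists>t\<in>T n. norm (f x t) < 1 / real (Suc m)}" by blast
  also have "\<dots> \<in> sets M"
  proof (intro sets.sets_Collect_countable_Ex sets.sets_Collect_countable_All)
    fix n m
    have "{x \<in> space M. norm (f x t) < 1 / real (Suc m)} \<in> sets M" if "t \<in> T n" for t
    proof -
      have [measurable]: "(\<lambda>x. norm (f x t)) \<in> borel_measurable M"
        using T(2) K(2) that by (intro meas) blast
      show ?thesis by measurable
    qed
    then have "(\<Union>t\<in>T n. {x \<in> space M. norm (f x t) < 1 / real (Suc m)}) \<in> sets M"
      using T(1) by (intro sets.countable_UN'') auto
    also have "(\<Union>t\<in>T n. {x \<in> space M. norm (f x t) < 1 / real (Suc m)})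
        = {x \<in> space M. \<exists>t\<in>T n. norm (f x t) < 1 / real (Suc m)}" by blast
    finally show "{x \<in> space M. \<exists>t\<in>T n. norm (f x t) < 1 / real (Suc m)} \<in> sets M" .
  qed
  finally show ?thesis .
qed

subsection \<open>Regular statistical models\<close>

lemma matrix_inv_inverse:
  fixes A :: "real^'d^'d::finite"
  assumes "invertible A"
  shows "matrix_inv A ** A = mat 1" "A ** matrix_inv A = mat 1"
  using someI_ex[OF assms[unfolded invertible_def]] unfolding matrix_inv_def by auto

lemma abs_entry_le_matrix_opnorm:
  fixes A :: "real^'d^'d::finite"
  shows "\<bar>A $ a $ i\<bar> \<le> matrix_opnorm A"
proof -
  have "\<bar>A $ a $ i\<bar> = \<bar>(A *v axis i 1) $ a\<bar>"
    by (simp add: matrix_vector_mul_component inner_axis)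
  also have "\<dots> \<le> norm (A *v axis i 1)" by (rule component_le_norm_cart)
  also have "\<dots> \<le> onorm ((*v) A) * norm (axis i 1 :: real^'d)"
    by (rule onorm[OF matrix_vector_mul_bounded_linear])
  finally show ?thesis by (simp add: matrix_opnorm_def)
qed

text \<open>An entry is the trilinear form at three basis vectors. The real supremum is an upper
  bound only once it is known to be over a bounded set, for which the sum of all absolute entries
  serves.\<close>

lemma abs_entry_le_tensor_opnorm:
  fixes T :: "real^'d^'d^'d::finite"
  shows "\<bar>T $ i $ j $ k\<bar> \<le> tensor_opnorm T"
proof -
  let ?f = "\<lambda>(u :: real^'d, v :: real^'d, w :: real^'d).
    \<bar>\<Sum>i\<in>UNIV. \<Sum>j\<in>UNIV. \<Sum>k\<in>UNIV. T $ i $ j $ k * u $ i * v $ j * w $ k\<bar>"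
  have "?f z \<le> (\<Sum>i\<in>UNIV. \<Sum>j\<in>UNIV. \<Sum>k\<in>UNIV. \<bar>T $ i $ j $ k\<bar>)"
    if z: "z \<in> sphere 0 1 \<times> sphere 0 1 \<times> sphere 0 1" for z
  proof -
    obtain u v w where z': "z = (u, v, w)" and n: "norm u = 1" "norm v = 1" "norm w = 1"
      using z by (cases z) auto
    have "\<bar>u $ i\<bar> \<le> 1" "\<bar>v $ i\<bar> \<le> 1" "\<bar>w $ i\<bar> \<le> 1" for i
      using n component_le_norm_cart[of u i] component_le_norm_cart[of v i] component_le_norm_cart[of w i] by auto
    then have "\<bar>T $ i $ j $ k * u $ i * v $ j * w $ k\<bar> \<le> \<bar>T $ i $ j $ k\<bar> * 1 * 1 * 1" for i j k
      unfolding abs_mult by (intro mult_mono) auto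
    then show ?thesis
      unfolding z' prod.case by (intro order_trans[OF sum_abs] sum_mono) auto
  qed
  then have "bdd_above (?f ` (sphere 0 1 \<times> sphere 0 1 \<times> sphere 0 1))"
    by (intro bdd_aboveI2)
  then have "?f (axis i 1, axis j 1, axis k 1) \<le> tensor_opnorm T"
    unfolding tensor_opnorm_def by (intro cSUP_upper) auto
  moreover have "(\<Sum>k\<in>UNIV. c k * axis l 1 $ k) = c l" for c :: "'d \<Rightarrow> real" and l
    by (simp add: axis_def mult_delta_right)
  ultimately show ?thesis by simp
qed

text \<open>\<open>S\<close> itself may fail to be measurable. It differs from \<open>E\<close> only
  inside a null set, and this puts it into the completed sigma-algebra. Meant for the event that the
  estimator is accurate.\<close>

lemma measure_completion_AE_eq:
  assumes M: "prob_space M" and E: "E \<in> sets M" and S: "S \<subseteq> space M"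
    and ae: "AE x in M. x \<in> S \<longleftrightarrow> x \<in> E"
  shows "measure (completion M) S = measure M E"
proof -
  interpret M: prob_space M by fact
  interpret C: prob_space "completion M" by (rule M.prob_space_completion)
  obtain N where N: "{x \<in> space M. \<not> (x \<in> S \<longleftrightarrow> x \<in> E)} \<subseteq> N" "N \<in> null_sets M"
    using ae by (elim AE_E) (auto intro: null_setsI)
  have "S = (E - N) \<union> (S \<inter> N)" using N(1) S sets.sets_into_space[OF E] by blast
  then have S': "S \<in> sets (completion M)"
    by (rule sets_completionI[OF _ _ N(2)]) (use N(2) E in auto)
  have "measure (completion M) S = measure (completion M) E"
    using AE_completion[OF ae] S' E by (intro C.finite_measure_eq_AE) auto
  then show ?thesis using E by simp
qed

text \<open>The moment bounds use \<open>nn_integral\<close> because a Bochner integral is 0 for a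
  function that is not integrable; a finite \<open>ennreal\<close> value also expresses that the
  moment exists.\<close>

locale regular_model =
  fixes \<mu> :: "'x measure"
    and p :: "real^'d::finite \<Rightarrow> 'x \<Rightarrow> real"
    and \<Theta> \<Theta>' :: "(real^'d) set"
    and r0 :: real
  assumes model_nonempty: "\<Theta> \<noteq> {}"
    and model_measurable: "\<And>\<theta>. \<theta> \<in> \<Theta>' \<Longrightarrow> p \<theta> \<in> borel_measurable \<mu>"
    and model_prob: "\<And>\<theta>. \<theta> \<in> \<Theta> \<Longrightarrow> prob_space (law \<mu> p \<theta>)"
    and score_mean: "\<And>\<theta>. \<theta> \<in> \<Theta> \<Longrightarrow>
          has_bochner_integral (law \<mu> p \<theta>) (\<lambda>x. gradient (loglik p x) \<theta>) 0"
    and fisher_exists: "\<And>\<theta>. \<theta> \<in> \<Theta> \<Longrightarrow>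
          integrable (law \<mu> p \<theta>) (\<lambda>x. outer_square (gradient (loglik p x) \<theta>))"
    and hessian_mean: "\<And>\<theta>. \<theta> \<in> \<Theta> \<Longrightarrow>
          has_bochner_integral (law \<mu> p \<theta>) (\<lambda>x. hessian (loglik p x) \<theta>) (- fisher \<mu> p \<theta>)"
    and A1: "\<And>M \<theta>. 1 \<le> M \<Longrightarrow> \<theta> \<in> \<Theta> \<Longrightarrow> AE xs in iid_law \<mu> p M \<theta>.
          {t \<in> \<Theta>'. gradient (sample_loglik p M xs) t = 0} = {mle \<Theta> p M xs}"
    and A2: "\<And>M xs. 1 \<le> M \<Longrightarrow> xs \<in> space (\<Pi>\<^sub>M i\<in>{..<M}. \<mu>) \<Longrightarrow> C3_on \<Theta>' (sample_loglik p M xs)"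
    and R1: "open \<Theta>'" "\<Theta> \<subseteq> \<Theta>'" "0 < r0"
          "\<And>\<theta> \<Delta>. \<theta> \<in> \<Theta> \<Longrightarrow> norm \<Delta> \<le> r0 \<Longrightarrow> \<theta> + \<Delta> \<in> \<Theta>'"
    and R2: "\<And>\<theta>. \<theta> \<in> \<Theta> \<Longrightarrow> invertible (fisher \<mu> p \<theta>)"
          "bdd_above ((\<lambda>\<theta>. matrix_opnorm (fisher_inv \<mu> p \<theta>)) ` \<Theta>)"
    and R3: "(SUP \<theta>\<in>\<Theta>. \<integral>\<^sup>+x. ennreal (trace
            ((hessian (loglik p x) \<theta> + fisher \<mu> p \<theta>) ** (hessian (loglik p x) \<theta> + fisher \<mu> p \<theta>)))
            \<partial>law \<mu> p \<theta>) < \<infinity>"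
    and R4: "(SUP \<theta>\<in>\<Theta>. \<integral>\<^sup>+x. (SUP \<Delta>\<in>cball 0 r0.
            ennreal (tensor_opnorm (third_deriv (loglik p x) (\<theta> + \<Delta>))))\<^sup>2 \<partial>law \<mu> p \<theta>) < \<infinity>"
    and R5: "(SUP \<theta>\<in>\<Theta>. SUP u\<in>sphere 0 1.
            (\<integral>\<^sup>+x. ennreal (\<bar>u \<bullet> (fisher_inv \<mu> p \<theta> *v gradient (loglik p x) \<theta>)\<bar> ^ 3) \<partial>law \<mu> p \<theta>) /
            ennreal ((u \<bullet> (fisher_inv \<mu> p \<theta> *v u)) powr (3 / 2))) < \<infinity>"
begin

abbreviation "F \<equiv> fisher \<mu> p"
abbreviation "A \<equiv> fisher_inv \<mu> p"
abbreviation "score x \<theta> \<equiv> gradient (loglik p x) \<theta>"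

lemma space_law [simp]: "space (law \<mu> p \<theta>) = space \<mu>"
  and sets_law [simp, measurable_cong]: "sets (law \<mu> p \<theta>) = sets \<mu>"
  by (simp_all add: law_def)

text \<open>A single outcome is a sample of size 1, so (A2) with \<open>M = 1\<close>
  applies.\<close>

lemma loglik_C3:
  assumes "x \<in> space \<mu>"
  shows "C3_on \<Theta>' (loglik p x)"
proof -
  have "(\<lambda>i\<in>{..<1}. x) \<in> space (\<Pi>\<^sub>M i\<in>{..<1::nat}. \<mu>)"
    using assms by (auto simp: space_PiM)
  from A2[OF _ this] have "C3_on \<Theta>' (sample_loglik p 1 (\<lambda>i\<in>{..<1}. x))" by simp
  moreover have "sample_loglik p 1 (\<lambda>i\<in>{..<1}. x) = loglik p x"
    by (rule ext) (simp add: sample_loglik_def)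
  ultimately show ?thesis by simp
qed

lemmas loglik_differentiable = C3_onD[OF loglik_C3 R1(1)]

section \<open>Measurability of the likelihood derivatives in the outcome\<close>

lemma loglik_measurable: "\<theta> \<in> \<Theta>' \<Longrightarrow> (\<lambda>x. loglik p x \<theta>) \<in> borel_measurable \<mu>"
  unfolding loglik_def using model_measurable by measurable

lemma score_measurable: "\<theta> \<in> \<Theta>' \<Longrightarrow> (\<lambda>x. score x \<theta> $ i) \<in> borel_measurable \<mu>"
  by (rule borel_measurable_gradient[OF R1(1)]) (auto intro: loglik_measurable loglik_differentiable(1))

lemma hessian_measurable: "\<theta> \<in> \<Theta>' \<Longrightarrow> (\<lambda>x. hessian (loglik p x) \<theta> $ i $ j) \<in> borel_measurable \<mu>"
  unfolding hessian_nth
  by (rule borel_measurable_gradient[OF R1(1)]) (auto intro: score_measurable loglik_differentiable(2))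

lemma third_deriv_measurable:
  "\<theta> \<in> \<Theta>' \<Longrightarrow> (\<lambda>x. third_deriv (loglik p x) \<theta> $ i $ j $ k) \<in> borel_measurable \<mu>"
  unfolding third_deriv_nth
  by (rule borel_measurable_gradient[OF R1(1)]) (auto intro: hessian_measurable loglik_differentiable(3))

lemma fisher_inverse:
  assumes "\<theta> \<in> \<Theta>"
  shows "A \<theta> ** F \<theta> = mat 1" "F \<theta> ** A \<theta> = mat 1"
  unfolding fisher_inv_def using matrix_inv_inverse[OF R2(1)[OF assms]] by auto

lemma fisher_inv_bounded: "\<exists>B\<ge>0. \<forall>\<theta>\<in>\<Theta>. \<forall>a i. \<bar>A \<theta> $ a $ i\<bar> \<le> B"
proof -
  obtain B where B: "\<And>\<theta>. \<theta> \<in> \<Theta> \<Longrightarrow> matrix_opnorm (A \<theta>) \<le> B"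
    using R2(2) by (auto simp: bdd_above_def)
  have "\<bar>A \<theta> $ a $ i\<bar> \<le> max 0 B" if "\<theta> \<in> \<Theta>" for \<theta> a i
    using abs_entry_le_matrix_opnorm[of "A \<theta>" a i] B[OF that] by linarith
  then show ?thesis by (intro exI[of _ "max 0 B"]) auto
qed

section \<open>Moments of score, Hessian and third derivatives\<close>

lemma score_integral:
  assumes "\<theta> \<in> \<Theta>"
  shows "integrable (law \<mu> p \<theta>) (\<lambda>x. score x \<theta> $ i)" "(\<integral>x. score x \<theta> $ i \<partial>law \<mu> p \<theta>) = 0"
  using has_bochner_integral_bounded_linear[OF bounded_linear_vec_nth score_mean[OF assms], of i]
  by (auto simp: has_bochner_integral_iff)

lemma hessian_integral:
  assumes "\<theta> \<in> \<Theta>"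
  shows "integrable (law \<mu> p \<theta>) (\<lambda>x. hessian (loglik p x) \<theta> $ i $ j)"
    "(\<integral>x. hessian (loglik p x) \<theta> $ i $ j \<partial>law \<mu> p \<theta>) = - F \<theta> $ i $ j"
  using has_bochner_integral_bounded_linear[OF bounded_linear_vec_nth
      has_bochner_integral_bounded_linear[OF bounded_linear_vec_nth hessian_mean[OF assms], of i], of j]
  by (auto simp: has_bochner_integral_iff)

lemma fisher_integral:
  assumes "\<theta> \<in> \<Theta>"
  shows "integrable (law \<mu> p \<theta>) (\<lambda>x. score x \<theta> $ i * score x \<theta> $ j)"
    "(\<integral>x. score x \<theta> $ i * score x \<theta> $ j \<partial>law \<mu> p \<theta>) = F \<theta> $ i $ j"
proof -
  have "has_bochner_integral (law \<mu> p \<theta>) (\<lambda>x. outer_square (score x \<theta>)) (F \<theta>)"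
    using fisher_exists[OF assms] by (simp add: has_bochner_integral_iff fisher_def)
  from has_bochner_integral_bounded_linear[OF bounded_linear_vec_nth
      has_bochner_integral_bounded_linear[OF bounded_linear_vec_nth this, of i], of j]
  show "integrable (law \<mu> p \<theta>) (\<lambda>x. score x \<theta> $ i * score x \<theta> $ j)"
    "(\<integral>x. score x \<theta> $ i * score x \<theta> $ j \<partial>law \<mu> p \<theta>) = F \<theta> $ i $ j"
    by (auto simp: has_bochner_integral_iff outer_square_def)
qed

lemma fisher_symmetric: "\<theta> \<in> \<Theta> \<Longrightarrow> F \<theta> $ i $ j = F \<theta> $ j $ i"
  using fisher_integral(2)[of \<theta> i j] fisher_integral(2)[of \<theta> j i] by (simp add: mult.commute)

text \<open>The efficient influence function of coordinate \<open>a\<close>: its sample mean is the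
  first order error of the maximum-likelihood estimator in that coordinate.\<close>

definition efficient_score :: "real^'d \<Rightarrow> 'd \<Rightarrow> 'x \<Rightarrow> real" where
  "efficient_score \<theta> a x = (A \<theta> *v score x \<theta>) $ a"

lemma efficient_score_sum: "efficient_score \<theta> a x = (\<Sum>i\<in>UNIV. A \<theta> $ a $ i * score x \<theta> $ i)"
  by (simp add: efficient_score_def matrix_vector_mult_def)

lemma efficient_score_mean:
  assumes "\<theta> \<in> \<Theta>"
  shows "integrable (law \<mu> p \<theta>) (efficient_score \<theta> a)" "(\<integral>x. efficient_score \<theta> a x \<partial>law \<mu> p \<theta>) = 0"
proof -
  show "integrable (law \<mu> p \<theta>) (efficient_score \<theta> a)"
    unfolding efficient_score_sum[abs_def] using score_integral[OF assms] by auto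
  show "(\<integral>x. efficient_score \<theta> a x \<partial>law \<mu> p \<theta>) = 0"
    unfolding efficient_score_sum using score_integral[OF assms] by (subst Bochner_Integration.integral_sum) auto
qed

text \<open>The matrix of these covariances is \<open>A \<theta> ** F \<theta>\<close>, the
  identity. Both the value and the positivity of the variance are read off from it.\<close>

lemma efficient_score_covariance:
  assumes "\<theta> \<in> \<Theta>"
  shows "integrable (law \<mu> p \<theta>) (\<lambda>x. efficient_score \<theta> a x * score x \<theta> $ j)"
    "(\<integral>x. efficient_score \<theta> a x * score x \<theta> $ j \<partial>law \<mu> p \<theta>) = (if a = j then 1 else 0)"
proof -
  have eq: "efficient_score \<theta> a x * score x \<theta> $ j = (\<Sum>i\<in>UNIV. A \<theta> $ a $ i * (score x \<theta> $ i * score x \<theta> $ j))" for x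
    by (simp add: efficient_score_sum sum_distrib_right mult.assoc)
  show "integrable (law \<mu> p \<theta>) (\<lambda>x. efficient_score \<theta> a x * score x \<theta> $ j)"
    unfolding eq using fisher_integral[OF assms] by auto
  have "(\<integral>x. efficient_score \<theta> a x * score x \<theta> $ j \<partial>law \<mu> p \<theta>) = (\<Sum>i\<in>UNIV. A \<theta> $ a $ i * F \<theta> $ i $ j)"
    unfolding eq using fisher_integral[OF assms] by (subst Bochner_Integration.integral_sum) auto
  also have "\<dots> = (A \<theta> ** F \<theta>) $ a $ j" by (simp add: matrix_matrix_mult_def)
  also have "\<dots> = (if a = j then 1 else 0)" by (simp add: fisher_inverse[OF assms] mat_def)
  finally show "(\<integral>x. efficient_score \<theta> a x * score x \<theta> $ j \<partial>law \<mu> p \<theta>) = (if a = j then 1 else 0)" .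
qed

lemma efficient_score_variance:
  assumes "\<theta> \<in> \<Theta>"
  shows "integrable (law \<mu> p \<theta>) (\<lambda>x. (efficient_score \<theta> a x)\<^sup>2)"
    "(\<integral>x. (efficient_score \<theta> a x)\<^sup>2 \<partial>law \<mu> p \<theta>) = A \<theta> $ a $ a"
    "0 < A \<theta> $ a $ a"
proof -
  have eq: "(efficient_score \<theta> a x)\<^sup>2 = (\<Sum>j\<in>UNIV. A \<theta> $ a $ j * (efficient_score \<theta> a x * score x \<theta> $ j))" for x
  proof -
    have "(efficient_score \<theta> a x)\<^sup>2 = efficient_score \<theta> a x * (\<Sum>j\<in>UNIV. A \<theta> $ a $ j * score x \<theta> $ j)"
      by (simp add: power2_eq_square flip: efficient_score_sum)
    then show ?thesis by (simp add: sum_distrib_left mult_ac)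
  qed
  show int: "integrable (law \<mu> p \<theta>) (\<lambda>x. (efficient_score \<theta> a x)\<^sup>2)"
    unfolding eq using efficient_score_covariance[OF assms] by auto
  show var: "(\<integral>x. (efficient_score \<theta> a x)\<^sup>2 \<partial>law \<mu> p \<theta>) = A \<theta> $ a $ a"
    unfolding eq using efficient_score_covariance[OF assms]
    by (subst Bochner_Integration.integral_sum) (auto simp: mult_delta_right)
  \<comment> \<open>With variance 0 the efficient score would vanish almost surely, and its
    covariance with coordinate \<open>a\<close> of the score could not be 1.\<close>
  have "A \<theta> $ a $ a \<noteq> 0"
  proof
    assume "A \<theta> $ a $ a = 0"
    with var have "AE x in law \<mu> p \<theta>. (efficient_score \<theta> a x)\<^sup>2 = 0"
      using int integral_nonneg_eq_0_iff_AE[OF int] by simp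
    then have "AE x in law \<mu> p \<theta>. efficient_score \<theta> a x * score x \<theta> $ a = 0" by eventually_elim simp
    then have "(\<integral>x. efficient_score \<theta> a x * score x \<theta> $ a \<partial>law \<mu> p \<theta>) = 0"
      by (rule integral_eq_zero_AE)
    then show False using efficient_score_covariance(2)[OF assms, of a a] by simp
  qed
  moreover have "0 \<le> (\<integral>x. (efficient_score \<theta> a x)\<^sup>2 \<partial>law \<mu> p \<theta>)" by simp
  ultimately show "0 < A \<theta> $ a $ a" using var by linarith
qed

text \<open>(R5) in the direction of a basis vector, where the quadratic form in the denominator is
  the variance of the efficient score. The bound is on the standardized third moment and thus scale
  free.\<close>

lemma efficient_score_third_moment:
  "\<exists>C. \<forall>\<theta>\<in>\<Theta>. \<forall>a. integrable (law \<mu> p \<theta>) (\<lambda>x. \<bar>efficient_score \<theta> a x\<bar> ^ 3) \<and>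
     (\<integral>x. \<bar>efficient_score \<theta> a x\<bar> ^ 3 \<partial>law \<mu> p \<theta>) \<le> C * sqrt (A \<theta> $ a $ a) ^ 3"
proof -
  let ?R = "\<lambda>\<theta> u. (\<integral>\<^sup>+x. ennreal (\<bar>u \<bullet> (A \<theta> *v score x \<theta>)\<bar> ^ 3) \<partial>law \<mu> p \<theta>) /
            ennreal ((u \<bullet> (A \<theta> *v u)) powr (3 / 2))"
  obtain c where c: "0 \<le> c" "(SUP \<theta>\<in>\<Theta>. SUP u\<in>sphere 0 1. ?R \<theta> u) = ennreal c"
    using R5 by (cases "(SUP \<theta>\<in>\<Theta>. SUP u\<in>sphere 0 1. ?R \<theta> u)") auto
  have "integrable (law \<mu> p \<theta>) (\<lambda>x. \<bar>efficient_score \<theta> a x\<bar> ^ 3) \<and>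
     (\<integral>x. \<bar>efficient_score \<theta> a x\<bar> ^ 3 \<partial>law \<mu> p \<theta>) \<le> (c + 1) * sqrt (A \<theta> $ a $ a) ^ 3"
    if \<theta>: "\<theta> \<in> \<Theta>" for \<theta> a
  proof -
    let ?s = "A \<theta> $ a $ a"
    have s: "0 < ?s" using efficient_score_variance(3)[OF \<theta>] .
    have powr: "?s powr (3 / 2) = sqrt ?s ^ 3"
      using s by (simp add: powr_half_sqrt[symmetric] powr_powr flip: powr_realpow)
    let ?u = "axis a 1 :: real^'d"
    have u1: "?u \<bullet> (A \<theta> *v score x \<theta>) = efficient_score \<theta> a x" for x
      by (simp add: inner_axis' efficient_score_def)
    have u2: "?u \<bullet> (A \<theta> *v ?u) = ?s"
      by (simp add: inner_axis' matrix_vector_mul_component inner_axis)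
    have "?R \<theta> ?u \<le> (SUP \<theta>\<in>\<Theta>. SUP u\<in>sphere 0 1. ?R \<theta> u)"
      using \<theta> by (intro SUP_upper2[of \<theta>] SUP_upper) auto
    \<comment> \<open>Passing from \<open>c\<close> to \<open>c + 1\<close> makes the bound strict,
      the form in which the \<open>ennreal\<close> quotient is cleared below.\<close>
    also have "\<dots> < ennreal (c + 1)"
      unfolding c(2) using c(1) by (simp add: ennreal_less_iff)
    finally have "(\<integral>\<^sup>+x. ennreal (\<bar>efficient_score \<theta> a x\<bar> ^ 3) \<partial>law \<mu> p \<theta>) / ennreal (sqrt ?s ^ 3) < ennreal (c + 1)"
      unfolding u1 u2 powr .
    then have bound: "(\<integral>\<^sup>+x. ennreal (\<bar>efficient_score \<theta> a x\<bar> ^ 3) \<partial>law \<mu> p \<theta>) < ennreal (c + 1) * ennreal (sqrt ?s ^ 3)"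
      using s by (subst (asm) divide_less_ennreal) auto
    have [measurable]: "efficient_score \<theta> a \<in> borel_measurable (law \<mu> p \<theta>)"
      using efficient_score_mean(1)[OF \<theta>] by auto
    have int: "integrable (law \<mu> p \<theta>) (\<lambda>x. \<bar>efficient_score \<theta> a x\<bar> ^ 3)"
      using bound by (intro integrableI_nonneg) (auto intro: order_less_trans simp: ennreal_mult_less_top)
    have "ennreal (\<integral>x. \<bar>efficient_score \<theta> a x\<bar> ^ 3 \<partial>law \<mu> p \<theta>) \<le> ennreal ((c + 1) * sqrt ?s ^ 3)"
      using bound c(1) s by (simp add: nn_integral_eq_integral[OF int] ennreal_mult less_imp_le)
    then show ?thesis using int c(1) s by (simp add: ennreal_le_iff)
  qed
  then show ?thesis by blast
qed

text \<open>For a symmetric matrix the trace of the square is the sum of the squared entries, so it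
  dominates each of them.\<close>

lemma hessian_deviation_moments:
  "\<exists>C\<ge>0. \<forall>\<theta>\<in>\<Theta>. \<forall>i j. integrable (law \<mu> p \<theta>) (\<lambda>x. (hessian (loglik p x) \<theta> $ i $ j + F \<theta> $ i $ j)\<^sup>2) \<and>
     (\<integral>x. (hessian (loglik p x) \<theta> $ i $ j + F \<theta> $ i $ j)\<^sup>2 \<partial>law \<mu> p \<theta>) \<le> C"
proof -
  let ?T = "\<lambda>\<theta> x. trace ((hessian (loglik p x) \<theta> + F \<theta>) ** (hessian (loglik p x) \<theta> + F \<theta>))"
  obtain c where c: "0 \<le> c" "(SUP \<theta>\<in>\<Theta>. \<integral>\<^sup>+x. ennreal (?T \<theta> x) \<partial>law \<mu> p \<theta>) = ennreal c"
    using R3 by (cases "SUP \<theta>\<in>\<Theta>. \<integral>\<^sup>+x. ennreal (?T \<theta> x) \<partial>law \<mu> p \<theta>") auto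
  have "integrable (law \<mu> p \<theta>) (\<lambda>x. (hessian (loglik p x) \<theta> $ i $ j + F \<theta> $ i $ j)\<^sup>2) \<and>
     (\<integral>x. (hessian (loglik p x) \<theta> $ i $ j + F \<theta> $ i $ j)\<^sup>2 \<partial>law \<mu> p \<theta>) \<le> c"
    if \<theta>: "\<theta> \<in> \<Theta>" for \<theta> i j
  proof -
    let ?Y = "\<lambda>x i j. hessian (loglik p x) \<theta> $ i $ j + F \<theta> $ i $ j"
    have [measurable]: "(\<lambda>x. hessian (loglik p x) \<theta> $ i $ j) \<in> borel_measurable \<mu>"
      using \<theta> R1(2) by (intro hessian_measurable) auto
    have le: "(?Y x i j)\<^sup>2 \<le> ?T \<theta> x" if x: "x \<in> space \<mu>" for x
    proof -
      have sym: "?Y x i j = ?Y x j i" for i j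
        using hessian_symmetric[OF loglik_C3[OF x] R1(1)] \<theta> R1(2) fisher_symmetric[OF \<theta>] by auto
      have "?T \<theta> x = (\<Sum>i\<in>UNIV. \<Sum>j\<in>UNIV. ?Y x i j * ?Y x j i)"
        by (simp add: trace_def matrix_matrix_mult_def)
      also have "\<dots> = (\<Sum>i\<in>UNIV. \<Sum>j\<in>UNIV. (?Y x i j)\<^sup>2)"
        unfolding power2_eq_square by (intro sum.cong refl arg_cong2[where f="(*)"] sym)
      finally have T: "?T \<theta> x = (\<Sum>i\<in>UNIV. \<Sum>j\<in>UNIV. (?Y x i j)\<^sup>2)" .
      have "(?Y x i j)\<^sup>2 \<le> (\<Sum>j\<in>UNIV. (?Y x i j)\<^sup>2)"
        by (rule member_le_sum) auto
      also have "\<dots> \<le> ?T \<theta> x"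
        unfolding T by (rule member_le_sum) (auto intro: sum_nonneg)
      finally show ?thesis .
    qed
    have "(\<integral>\<^sup>+x. ennreal ((?Y x i j)\<^sup>2) \<partial>law \<mu> p \<theta>) \<le> (\<integral>\<^sup>+x. ennreal (?T \<theta> x) \<partial>law \<mu> p \<theta>)"
      using le by (intro nn_integral_mono ennreal_leI) auto
    also have "\<dots> \<le> ennreal c"
      unfolding c(2)[symmetric] using \<theta> by (intro SUP_upper)
    finally have bound: "(\<integral>\<^sup>+x. ennreal ((?Y x i j)\<^sup>2) \<partial>law \<mu> p \<theta>) \<le> ennreal c" .
    have int: "integrable (law \<mu> p \<theta>) (\<lambda>x. (?Y x i j)\<^sup>2)"
      using bound by (intro integrableI_nonneg) (auto intro: order_le_less_trans)
    have "ennreal (\<integral>x. (?Y x i j)\<^sup>2 \<partial>law \<mu> p \<theta>) \<le> ennreal c"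
      using bound by (simp add: nn_integral_eq_integral[OF int])
    then show ?thesis using int c(1) by (simp add: ennreal_le_iff)
  qed
  then show ?thesis using c(1) by blast
qed

text \<open>The supremum in (R4) need not be measurable in \<open>x\<close>, in which case its \<open>nn_integral\<close> is only a
  lower integral. The envelope takes the supremum over a countable dense set instead.\<close>

lemma third_deriv_envelope:
  "\<exists>G C. 0 \<le> C \<and> (\<forall>\<theta>\<in>\<Theta>. G \<theta> \<in> borel_measurable \<mu> \<and> (\<integral>\<^sup>+x. G \<theta> x \<partial>law \<mu> p \<theta>) \<le> ennreal C \<and>
     (\<forall>x\<in>space \<mu>. G \<theta> x < \<infinity> \<longrightarrow> (\<forall>D i j k. norm D \<le> r0 \<longrightarrow>
        \<bar>third_deriv (loglik p x) (\<theta> + D) $ i $ j $ k\<bar> \<le> enn2real (G \<theta> x))))"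
proof -
  let ?N = "\<lambda>\<theta> x. SUP \<Delta>\<in>cball 0 r0. ennreal (tensor_opnorm (third_deriv (loglik p x) (\<theta> + \<Delta>)))"
  obtain c where c: "0 \<le> c" "(SUP \<theta>\<in>\<Theta>. \<integral>\<^sup>+x. (?N \<theta> x)\<^sup>2 \<partial>law \<mu> p \<theta>) = ennreal c"
    using R4 by (cases "SUP \<theta>\<in>\<Theta>. \<integral>\<^sup>+x. (?N \<theta> x)\<^sup>2 \<partial>law \<mu> p \<theta>") auto
  obtain T where T: "countable T" "T \<subseteq> cball (0 :: real^'d) r0" "cball 0 r0 \<subseteq> closure T"
    using separable[of "cball (0 :: real^'d) r0"] by metis
  define G where "G \<theta> x = (SUP (D, i, j, k) \<in> T \<times> UNIV.
      ennreal \<bar>third_deriv (loglik p x) (\<theta> + D) $ i $ j $ k\<bar>)" for \<theta> x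
  have main: "G \<theta> \<in> borel_measurable \<mu>" "(\<integral>\<^sup>+x. G \<theta> x \<partial>law \<mu> p \<theta>) \<le> ennreal (1 + c)"
    "\<And>x D i j k. x \<in> space \<mu> \<Longrightarrow> G \<theta> x < \<infinity> \<Longrightarrow> norm D \<le> r0 \<Longrightarrow>
       \<bar>third_deriv (loglik p x) (\<theta> + D) $ i $ j $ k\<bar> \<le> enn2real (G \<theta> x)"
    if \<theta>: "\<theta> \<in> \<Theta>" for \<theta>
  proof -
    have T\<Theta>: "\<theta> + D \<in> \<Theta>'" if "D \<in> T" for D
      using that T(2) by (intro R1(4)[OF \<theta>]) auto
    have "countable (T \<times> (UNIV :: ('d \<times> 'd \<times> 'd) set))"
      using T(1) by (intro countable_SIGMA) (auto intro: countable_finite)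
    then have Gm: "(\<lambda>x. G \<theta> x) \<in> borel_measurable \<mu>"
      unfolding G_def
    proof (rule borel_measurable_SUP)
      fix z assume "z \<in> T \<times> (UNIV :: ('d \<times> 'd \<times> 'd) set)"
      then obtain D i j k where z: "z = (D, i, j, k)" "D \<in> T" by auto
      have [measurable]: "(\<lambda>x. third_deriv (loglik p x) (\<theta> + D) $ i $ j $ k) \<in> borel_measurable \<mu>"
        using T\<Theta>[OF z(2)] by (rule third_deriv_measurable)
      show "(\<lambda>x. case z of (D, i, j, k) \<Rightarrow> ennreal \<bar>third_deriv (loglik p x) (\<theta> + D) $ i $ j $ k\<bar>)
          \<in> borel_measurable \<mu>"
        unfolding z(1) prod.case by measurable
    qed
    then show "G \<theta> \<in> borel_measurable \<mu>" .
    note [measurable] = Gm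
    have GN: "G \<theta> x \<le> ?N \<theta> x" for x
      unfolding G_def
    proof (rule SUP_least)
      fix z assume "z \<in> T \<times> (UNIV :: ('d \<times> 'd \<times> 'd) set)"
      then obtain D i j k where z: "z = (D, i, j, k)" "D \<in> T" by auto
      have "ennreal \<bar>third_deriv (loglik p x) (\<theta> + D) $ i $ j $ k\<bar>
          \<le> ennreal (tensor_opnorm (third_deriv (loglik p x) (\<theta> + D)))"
        by (intro ennreal_leI abs_entry_le_tensor_opnorm)
      also have "\<dots> \<le> ?N \<theta> x" using z(2) T(2) by (intro SUP_upper) auto
      finally show "(case z of (D, i, j, k) \<Rightarrow> ennreal \<bar>third_deriv (loglik p x) (\<theta> + D) $ i $ j $ k\<bar>) \<le> ?N \<theta> x"
        unfolding z(1) prod.case .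
    qed
    \<comment> \<open>(R4) controls a second moment, Markov's inequality needs a first one; the
      summand 1 integrates to 1 and explains the constant \<open>1 + c\<close>.\<close>
    have sq: "g \<le> 1 + g\<^sup>2" for g :: ennreal
    proof (cases "g \<le> 1")
      case True
      then show ?thesis by (simp add: add_increasing2)
    next
      case False
      then have "g * 1 \<le> g * g" by (intro mult_left_mono) auto
      then show ?thesis by (simp add: power2_eq_square add_increasing)
    qed
    interpret L: prob_space "law \<mu> p \<theta>" using \<theta> by (rule model_prob)
    have "(\<integral>\<^sup>+x. G \<theta> x \<partial>law \<mu> p \<theta>) \<le> (\<integral>\<^sup>+x. 1 + (G \<theta> x)\<^sup>2 \<partial>law \<mu> p \<theta>)"
      by (intro nn_integral_mono sq)
    also have "\<dots> = 1 + (\<integral>\<^sup>+x. (G \<theta> x)\<^sup>2 \<partial>law \<mu> p \<theta>)"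
      by (subst nn_integral_add) (auto simp: L.emeasure_space_1[simplified])
    also have "(\<integral>\<^sup>+x. (G \<theta> x)\<^sup>2 \<partial>law \<mu> p \<theta>) \<le> (\<integral>\<^sup>+x. (?N \<theta> x)\<^sup>2 \<partial>law \<mu> p \<theta>)"
      by (intro nn_integral_mono power_mono GN) auto
    also have "\<dots> \<le> ennreal c"
      unfolding c(2)[symmetric] using \<theta> by (intro SUP_upper)
    also have "1 + ennreal c = ennreal (1 + c)" using c(1) by simp
    finally show "(\<integral>\<^sup>+x. G \<theta> x \<partial>law \<mu> p \<theta>) \<le> ennreal (1 + c)" by (simp add: add_left_mono)
    fix x i j k and D :: "real^'d" assume x: "x \<in> space \<mu>" and fin: "G \<theta> x < \<infinity>" and D: "norm D \<le> r0"
    let ?t = "\<lambda>D. third_deriv (loglik p x) (\<theta> + D) $ i $ j $ k"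
    have clT: "closure T \<subseteq> cball 0 r0" using T(2) by (intro closure_minimal) auto
    have "continuous_on \<Theta>' (third_deriv (loglik p x))"
      using loglik_C3[OF x] by (simp add: C3_on_def)
    then have "continuous_on (closure T) (\<lambda>D. third_deriv (loglik p x) (\<theta> + D))"
      by (rule continuous_on_compose2) (use clT R1(4)[OF \<theta>] in \<open>auto intro!: continuous_intros\<close>)
    then have cont: "continuous_on (closure T) (\<lambda>D. \<bar>?t D\<bar>)"
      by (intro continuous_intros)
    have le: "\<bar>?t D\<bar> \<le> enn2real (G \<theta> x)" if "D \<in> T" for D
    proof -
      have "ennreal \<bar>?t D\<bar> \<le> G \<theta> x"
        unfolding G_def using that by (intro SUP_upper2[of "(D, i, j, k)"]) auto
      then show ?thesis using fin enn2real_mono[of "ennreal \<bar>?t D\<bar>" "G \<theta> x"] by simp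
    qed
    \<comment> \<open>Continuity of the third derivatives carries the bound from the dense set to
      the whole ball.\<close>
    have "D \<in> closure T" using T(3) D by auto
    then show "\<bar>?t D\<bar> \<le> enn2real (G \<theta> x)"
      by (rule continuous_le_on_closure[OF cont]) (rule le)
  qed
  then show ?thesis using c(1) by (intro exI[of _ G] exI[of _ "1 + c"]) auto
qed

abbreviation "V \<equiv> worst_variance \<mu> \<Theta> p"

lemma fisher_inv_le_worst_variance:
  assumes "\<theta> \<in> \<Theta>"
  shows "A \<theta> $ a $ a \<le> V"
proof -
  obtain B where B: "\<And>\<theta> a i. \<theta> \<in> \<Theta> \<Longrightarrow> \<bar>A \<theta> $ a $ i\<bar> \<le> B" using fisher_inv_bounded by blast
  have "A \<theta> $ a $ a \<le> (MAX a. A \<theta> $ a $ a)" by (intro Max_ge) auto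
  also have "\<dots> \<le> V"
    unfolding worst_variance_def
  proof (rule cSUP_upper[OF assms])
    have "(MAX a. A \<theta> $ a $ a) \<le> B" if "\<theta> \<in> \<Theta>" for \<theta>
      using B[OF that] by (intro Max.boundedI) (auto intro: order_trans[OF abs_ge_self])
    then show "bdd_above ((\<lambda>\<theta>. MAX a. A \<theta> $ a $ a) ` \<Theta>)" by (intro bdd_aboveI2)
  qed
  finally show ?thesis .
qed

lemma worst_variance_pos: "0 < V"
proof -
  obtain \<theta> where "\<theta> \<in> \<Theta>" using model_nonempty by blast
  then show ?thesis
    using efficient_score_variance(3) fisher_inv_le_worst_variance by (meson less_le_trans)
qed

section \<open>The sampling law and the event of an accurate estimate\<close>

lemma space_iid_law [simp]: "space (iid_law \<mu> p M \<theta>) = space (\<Pi>\<^sub>M i\<in>{..<M}. \<mu>)"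
  by (simp add: iid_law_def space_PiM)

lemma sets_iid_law [simp, measurable_cong]: "sets (iid_law \<mu> p M \<theta>) = sets (\<Pi>\<^sub>M i\<in>{..<M}. \<mu>)"
  unfolding iid_law_def by (intro sets_PiM_cong) auto

lemma prob_space_iid_law: "\<theta> \<in> \<Theta> \<Longrightarrow> prob_space (iid_law \<mu> p M \<theta>)"
  unfolding iid_law_def by (intro prob_space_PiM model_prob)

lemma gradient_sample_loglik:
  assumes "xs \<in> space (\<Pi>\<^sub>M i\<in>{..<M}. \<mu>)" "t \<in> \<Theta>'"
  shows "gradient (sample_loglik p M xs) t = (\<Sum>k<M. score (xs k) t)"
proof -
  have "gradient (\<lambda>t. \<Sum>k<M. loglik p (xs k) t) t = (\<Sum>k<M. score (xs k) t)"
    using assms by (intro gradient_sum loglik_differentiable(1)) (auto simp: space_PiM PiE_iff)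
  then show ?thesis by (simp add: sample_loglik_def[abs_def])
qed

text \<open>Unlike the estimator itself, this event is measurable without any assumption on \<open>\<Theta>\<close>.\<close>

definition stationary_event :: "nat \<Rightarrow> real^'d \<Rightarrow> real \<Rightarrow> (nat \<Rightarrow> 'x) set" where
  "stationary_event M \<theta> e = {xs \<in> space (\<Pi>\<^sub>M i\<in>{..<M}. \<mu>).
     \<exists>t\<in>\<Theta>'. t \<in> {t. infnorm (t - \<theta>) \<le> e} \<and> gradient (sample_loglik p M xs) t = 0}"

lemma sets_stationary_event:
  assumes "1 \<le> M"
  shows "stationary_event M \<theta> e \<in> sets (\<Pi>\<^sub>M i\<in>{..<M}. \<mu>)"
  unfolding stationary_event_def
proof (rule measurable_exists_zero[OF R1(1)])
  show "closed {t. infnorm (t - \<theta>) \<le> e}"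
    by (intro closed_Collect_le continuous_intros)
  show "continuous_on \<Theta>' (gradient (sample_loglik p M xs))" if "xs \<in> space (\<Pi>\<^sub>M i\<in>{..<M}. \<mu>)" for xs
    using A2[OF assms that] by (auto simp: C3_on_def intro: differentiable_imp_continuous_on)
  fix t assume t: "t \<in> \<Theta>'"
  have [measurable]: "(\<lambda>x. score x t $ i) \<in> borel_measurable \<mu>" for i
    using t by (rule score_measurable)
  have "(\<lambda>xs. sqrt (\<Sum>i\<in>UNIV. (\<Sum>k<M. score (xs k) t $ i)\<^sup>2)) \<in> borel_measurable (\<Pi>\<^sub>M i\<in>{..<M}. \<mu>)"
    by measurable
  then show "(\<lambda>xs. norm (gradient (sample_loglik p M xs) t)) \<in> borel_measurable (\<Pi>\<^sub>M i\<in>{..<M}. \<mu>)"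
    by (subst measurable_cong[where g="\<lambda>xs. sqrt (\<Sum>i\<in>UNIV. (\<Sum>k<M. score (xs k) t $ i)\<^sup>2)"])
      (auto simp: gradient_sample_loglik[OF _ t] norm_vec_def L2_set_def)
qed

text \<open>Almost surely the stationary points in \<open>\<Theta>'\<close> form the singleton of
  the estimator by (A1), so one of them lies in the cube exactly when the estimator does.\<close>

lemma ml_event_probability:
  assumes M: "1 \<le> M" and \<theta>: "\<theta> \<in> \<Theta>"
  shows "measure (completion (iid_law \<mu> p M \<theta>))
      {xs \<in> space (iid_law \<mu> p M \<theta>). infnorm (mle \<Theta> p M xs - \<theta>) \<le> e}
    = measure (iid_law \<mu> p M \<theta>) (stationary_event M \<theta> e)"
proof (rule measure_completion_AE_eq[OF prob_space_iid_law[OF \<theta>]])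
  show "AE xs in iid_law \<mu> p M \<theta>.
      xs \<in> {xs \<in> space (iid_law \<mu> p M \<theta>). infnorm (mle \<Theta> p M xs - \<theta>) \<le> e} \<longleftrightarrow> xs \<in> stationary_event M \<theta> e"
    using A1[OF M \<theta>]
  proof eventually_elim
    case (elim xs)
    then have iff: "t \<in> \<Theta>' \<and> gradient (sample_loglik p M xs) t = 0 \<longleftrightarrow> t = mle \<Theta> p M xs" for t
      by blast
    have "(\<exists>t\<in>\<Theta>'. t \<in> {t. infnorm (t - \<theta>) \<le> e} \<and> gradient (sample_loglik p M xs) t = 0)
        \<longleftrightarrow> (\<exists>t. (t \<in> \<Theta>' \<and> gradient (sample_loglik p M xs) t = 0) \<and> infnorm (t - \<theta>) \<le> e)"
      by blast
    also have "\<dots> \<longleftrightarrow> infnorm (mle \<Theta> p M xs - \<theta>) \<le> e" unfolding iff by simp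
    finally show ?case by (simp add: stationary_event_def)
  qed
qed (use sets_stationary_event[OF M] in auto)

text \<open>Division by the standard deviation gives unit variance and a third moment bounded by one
  \<open>C\<close> for all \<open>\<theta>\<close> and \<open>a\<close>; this is why a single
  \<open>M0\<close> comes out of the uniform limit theorem.\<close>

lemma efficient_score_tail:
  assumes t: "0 < t" and \<eta>: "0 < \<eta>"
  shows "\<exists>M0\<ge>1. \<forall>M\<ge>M0. \<forall>\<theta>\<in>\<Theta>. \<forall>a. measure (iid_law \<mu> p M \<theta>)
      {xs \<in> space (iid_law \<mu> p M \<theta>). t * sqrt (A \<theta> $ a $ a) * sqrt (real M) < \<bar>\<Sum>k<M. efficient_score \<theta> a (xs k)\<bar>}
    < 2 * (std_normal_density t / t) + \<eta>"
proof -
  obtain C where C: "\<And>\<theta> a. \<theta> \<in> \<Theta> \<Longrightarrow> integrable (law \<mu> p \<theta>) (\<lambda>x. \<bar>efficient_score \<theta> a x\<bar> ^ 3)"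
    "\<And>\<theta> a. \<theta> \<in> \<Theta> \<Longrightarrow> (\<integral>x. \<bar>efficient_score \<theta> a x\<bar> ^ 3 \<partial>law \<mu> p \<theta>) \<le> C * sqrt (A \<theta> $ a $ a) ^ 3"
    using efficient_score_third_moment by blast
  obtain M0 where M0: "1 \<le> M0" and clt: "\<forall>M\<ge>M0. \<forall>(P :: 'x measure) X. prob_space P \<longrightarrow> X \<in> borel_measurable P \<longrightarrow>
    integrable P (\<lambda>x. \<bar>X x\<bar> ^ 3) \<longrightarrow> (\<integral>x. \<bar>X x\<bar> ^ 3 \<partial>P) \<le> C \<longrightarrow>
    integrable P X \<longrightarrow> integrable P (\<lambda>x. (X x)\<^sup>2) \<longrightarrow> (\<integral>x. X x \<partial>P) = 0 \<longrightarrow> (\<integral>x. (X x)\<^sup>2 \<partial>P) = 1 \<longrightarrow>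
    measure (\<Pi>\<^sub>M i\<in>{..<M}. P) {xs \<in> space (\<Pi>\<^sub>M i\<in>{..<M}. P). t < \<bar>(\<Sum>i<M. X (xs i)) / sqrt (real M)\<bar>}
      < 2 * (std_normal_density t / t) + \<eta>"
    using uniform_clt_tail[OF t \<eta>, of C] by blast
  show ?thesis
  proof (intro exI[of _ M0] conjI allI impI ballI M0)
    fix M \<theta> a assume M: "M0 \<le> M" and \<theta>: "\<theta> \<in> \<Theta>"
    let ?s = "sqrt (A \<theta> $ a $ a)" and ?P = "law \<mu> p \<theta>"
    let ?X = "\<lambda>x. efficient_score \<theta> a x / ?s"
    note mean = efficient_score_mean[OF \<theta>, of a] and var = efficient_score_variance[OF \<theta>, of a]
    have s: "0 < ?s" using var(3) by simp
    have s2: "?s\<^sup>2 = A \<theta> $ a $ a" using var(3) by simp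
    have rM: "0 < sqrt (real M)" using M M0 by simp
    have m3: "(\<integral>x. \<bar>?X x\<bar> ^ 3 \<partial>?P) \<le> C"
    proof -
      have "(\<integral>x. \<bar>?X x\<bar> ^ 3 \<partial>?P) = (\<integral>x. \<bar>efficient_score \<theta> a x\<bar> ^ 3 \<partial>?P) / ?s ^ 3"
        using s by (simp add: abs_divide power_divide)
      also have "\<dots> \<le> C" using C(2)[OF \<theta>, of a] s by (simp add: pos_divide_le_eq)
      finally show ?thesis .
    qed
    have "measure (\<Pi>\<^sub>M i\<in>{..<M}. ?P) {xs \<in> space (\<Pi>\<^sub>M i\<in>{..<M}. ?P). t < \<bar>(\<Sum>i<M. ?X (xs i)) / sqrt (real M)\<bar>}
      < 2 * (std_normal_density t / t) + \<eta>"
    proof (rule clt[rule_format, OF M])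
      show "integrable ?P (\<lambda>x. \<bar>?X x\<bar> ^ 3)"
        using C(1)[OF \<theta>, of a] by (simp add: abs_divide power_divide)
      show "(\<integral>x. (?X x)\<^sup>2 \<partial>?P) = 1" using var s2 s by (simp add: power_divide)
      show "integrable ?P (\<lambda>x. (?X x)\<^sup>2)" using var by (simp add: power_divide)
    qed (use model_prob[OF \<theta>] mean m3 in auto)
    moreover have "t < \<bar>(\<Sum>i<M. ?X (xs i)) / sqrt (real M)\<bar> \<longleftrightarrow>
        t * ?s * sqrt (real M) < \<bar>\<Sum>k<M. efficient_score \<theta> a (xs k)\<bar>" for xs
    proof -
      have "\<bar>(\<Sum>i<M. ?X (xs i)) / sqrt (real M)\<bar> = \<bar>\<Sum>k<M. efficient_score \<theta> a (xs k)\<bar> / (?s * sqrt (real M))"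
        using s rM by (simp add: abs_divide flip: sum_divide_distrib)
      then show ?thesis using s rM by (simp add: pos_less_divide_eq mult.assoc)
    qed
    ultimately show "measure (iid_law \<mu> p M \<theta>)
      {xs \<in> space (iid_law \<mu> p M \<theta>). t * ?s * sqrt (real M) < \<bar>\<Sum>k<M. efficient_score \<theta> a (xs k)\<bar>}
      < 2 * (std_normal_density t / t) + \<eta>"
      unfolding iid_law_def by simp
  qed
qed

text \<open>A union bound with \<open>gap\<close> as error budget: each of the
  \<open>CARD('d)\<close> score events may exceed its normal bound by
  \<open>gap / (4 * CARD('d))\<close>, each Hessian entry event gets
  \<open>gap / (4 * CARD('d)\<^sup>2)\<close>, and the envelope event gets \<open>gap / 4\<close>.
  Together they spend three quarters of \<open>gap\<close>.\<close>

lemma ml_guarantee_eventually: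
  assumes \<kappa>: "0 < \<kappa>" "\<kappa> < 1" and t: "0 < t"
    and tail: "real CARD('d) * (2 * (std_normal_density t / t)) < \<delta>"
  shows "\<exists>e0>0. \<exists>M0\<ge>1. \<forall>e M. 0 < e \<longrightarrow> e \<le> e0 \<longrightarrow> M0 \<le> M \<longrightarrow>
    t * sqrt V * sqrt (real M) \<le> real M * ((1 - \<kappa>) * e) \<longrightarrow> ml_guarantee \<mu> \<Theta> p \<delta> e M"
proof -
  let ?d = "real CARD('d)"
  define gap where "gap = \<delta> - ?d * (2 * (std_normal_density t / t))"
  have gap: "0 < gap" using tail by (simp add: gap_def)
  have d: "1 \<le> ?d" by (simp add: Suc_le_eq)
  obtain B where B: "0 \<le> B" "\<And>\<theta> a i. \<theta> \<in> \<Theta> \<Longrightarrow> \<bar>A \<theta> $ a $ i\<bar> \<le> B"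
    using fisher_inv_bounded by blast
  obtain C where C: "0 \<le> C"
    "\<And>\<theta> i j. \<theta> \<in> \<Theta> \<Longrightarrow> integrable (law \<mu> p \<theta>) (\<lambda>x. (hessian (loglik p x) \<theta> $ i $ j + F \<theta> $ i $ j)\<^sup>2)"
    "\<And>\<theta> i j. \<theta> \<in> \<Theta> \<Longrightarrow> (\<integral>x. (hessian (loglik p x) \<theta> $ i $ j + F \<theta> $ i $ j)\<^sup>2 \<partial>law \<mu> p \<theta>) \<le> C"
    using hessian_deviation_moments by blast
  obtain G c where c: "0 \<le> c"
    and G: "\<And>\<theta>. \<theta> \<in> \<Theta> \<Longrightarrow> G \<theta> \<in> borel_measurable \<mu>"
      "\<And>\<theta>. \<theta> \<in> \<Theta> \<Longrightarrow> (\<integral>\<^sup>+x. G \<theta> x \<partial>law \<mu> p \<theta>) \<le> ennreal c"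
      "\<And>\<theta> x D i j k. \<theta> \<in> \<Theta> \<Longrightarrow> x \<in> space \<mu> \<Longrightarrow> G \<theta> x < \<infinity> \<Longrightarrow> norm D \<le> r0 \<Longrightarrow>
        \<bar>third_deriv (loglik p x) (\<theta> + D) $ i $ j $ k\<bar> \<le> enn2real (G \<theta> x)"
    using third_deriv_envelope by blast
  \<comment> \<open>\<open>\<eta>\<close> and the second bound in \<open>e0\<close> make the Hessian
    error and the cubic remainder at most \<open>\<kappa> / 2 * e\<close> each;
    \<open>r0 / ?d\<close> keeps the cube inside the ball of (R1). \<open>K\<close> makes Markov's
    bound at most \<open>gap / 4\<close>. Adding 1 to \<open>B\<close> and \<open>c\<close> excludes
    zero.\<close>
  define \<eta> where "\<eta> = \<kappa> / (2 * ?d\<^sup>2 * (B + 1))"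
  define K where "K = 4 * (c + 1) / gap"
  define e0 where "e0 = min (r0 / ?d) (\<kappa> / (2 * ?d ^ 3 * (B + 1) * K))"
  have \<eta>: "0 < \<eta>" using \<kappa> B(1) d by (simp add: \<eta>_def)
  have K: "0 < K" "c / K \<le> gap / 4" using gap c by (auto simp: K_def field_simps)
  have e0: "0 < e0" using R1(3) \<kappa> B(1) K(1) d by (simp add: e0_def)
  obtain M1 where M1: "1 \<le> M1" and score: "\<And>M \<theta> a. M1 \<le> M \<Longrightarrow> \<theta> \<in> \<Theta> \<Longrightarrow> measure (iid_law \<mu> p M \<theta>)
      {xs \<in> space (iid_law \<mu> p M \<theta>). t * sqrt (A \<theta> $ a $ a) * sqrt (real M) < \<bar>\<Sum>k<M. efficient_score \<theta> a (xs k)\<bar>}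
    < 2 * (std_normal_density t / t) + gap / (4 * ?d)"
    using efficient_score_tail[OF t, of "gap / (4 * ?d)"] gap d by auto
  \<comment> \<open>The second entry is the sample size at which Chebyshev's bound drops to
    \<open>gap / (4 * ?d\<^sup>2)\<close>.\<close>
  define M0 where "M0 = max M1 (nat \<lceil>4 * ?d\<^sup>2 * C / (gap * \<eta>\<^sup>2)\<rceil>)"
  have "ml_guarantee \<mu> \<Theta> p \<delta> e M"
    if e: "0 < e" "e \<le> e0" and M: "M0 \<le> M" and tM: "t * sqrt V * sqrt (real M) \<le> real M * ((1 - \<kappa>) * e)" for e M
    unfolding ml_guarantee_def
  proof
    fix \<theta> assume \<theta>: "\<theta> \<in> \<Theta>"
    have M_ge: "1 \<le> M" "M1 \<le> M" using M M1 by (auto simp: M0_def)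
    have M_large: "4 * ?d\<^sup>2 * C / (gap * \<eta>\<^sup>2) \<le> real M"
      using M unfolding M0_def by linarith
    let ?P = "law \<mu> p \<theta>" and ?Q = "iid_law \<mu> p M \<theta>"
    interpret P: prob_space ?P using \<theta> by (rule model_prob)
    interpret Q: prob_space ?Q using \<theta> by (rule prob_space_iid_law)
    let ?Y = "\<lambda>i j x. hessian (loglik p x) \<theta> $ i $ j + F \<theta> $ i $ j"
    define S where "S a = {xs \<in> space ?Q. t * sqrt (A \<theta> $ a $ a) * sqrt (real M) < \<bar>\<Sum>k<M. efficient_score \<theta> a (xs k)\<bar>}" for a
    define H where "H i j = {xs \<in> space ?Q. real M * \<eta> \<le> \<bar>\<Sum>k<M. ?Y i j (xs k)\<bar>}" for i j
    define T where "T = {xs \<in> space ?Q. ennreal (real M * K) \<le> (\<Sum>k<M. G \<theta> (xs k))}"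
    have \<theta>': "\<theta> \<in> \<Theta>'" using \<theta> R1(2) by blast
    have [measurable]: "efficient_score \<theta> a \<in> borel_measurable \<mu>" for a
      using borel_measurable_integrable[OF efficient_score_mean(1)[OF \<theta>]] by simp
    have [measurable]: "(\<lambda>x. hessian (loglik p x) \<theta> $ i $ j) \<in> borel_measurable \<mu>" for i j
      using \<theta>' by (rule hessian_measurable)
    note [measurable] = G(1)[OF \<theta>]
    have Sm [measurable]: "S a \<in> sets ?Q" for a unfolding S_def by measurable
    have Hm [measurable]: "H i j \<in> sets ?Q" for i j unfolding H_def by measurable
    have Tm [measurable]: "T \<in> sets ?Q" unfolding T_def by measurable
    have E: "stationary_event M \<theta> e \<in> sets ?Q" using sets_stationary_event[OF M_ge(1)] by simp
    have mH: "measure ?Q (H i j) \<le> gap / (4 * ?d\<^sup>2)" for i j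
    proof -
      have "measure ?Q (H i j) \<le> (\<integral>x. (?Y i j x)\<^sup>2 \<partial>?P) / (real M * \<eta>\<^sup>2)"
        unfolding H_def iid_law_def
        using hessian_integral[OF \<theta>, of i j] C(2)[OF \<theta>] \<eta> M_ge(1) P.prob_space_axioms
        by (intro iid_chebyshev) (auto simp: P.prob_space[simplified])
      also have "\<dots> \<le> C / (real M * \<eta>\<^sup>2)" using C(3)[OF \<theta>] by (intro divide_right_mono) auto
      also have "\<dots> \<le> gap / (4 * ?d\<^sup>2)"
        using M_large M_ge(1) \<eta> gap d by (simp add: field_simps)
      finally show ?thesis .
    qed
    have mT: "measure ?Q T \<le> gap / 4"
      unfolding T_def iid_law_def
      using G(1,2)[OF \<theta>] M_ge(1) K c P.prob_space_axioms
      by (intro order_trans[OF iid_markov]) auto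
    have sub: "space ?Q - stationary_event M \<theta> e \<subseteq> (\<Union>a. S a) \<union> (\<Union>z. H (fst z) (snd z)) \<union> T"
    proof (rule subsetI, rule ccontr)
      fix xs
      assume "xs \<in> space ?Q - stationary_event M \<theta> e"
      then have xs: "xs \<in> space ?Q" "xs \<notin> stationary_event M \<theta> e" by auto
      assume bad: "xs \<notin> (\<Union>a. S a) \<union> (\<Union>z. H (fst z) (snd z)) \<union> T"
      have nS: "xs \<notin> S a" and nT: "xs \<notin> T" for a using bad by blast+
      have nH: "xs \<notin> H i j" for i j using bad by force
      have xk: "xs k \<in> space \<mu>" if "k < M" for k
        using xs(1) that by (auto simp: space_PiM PiE_iff)
      \<comment> \<open>Outside \<open>T\<close> the sum of the envelopes is finite, hence so is
        each of them, and \<open>enn2real\<close> loses nothing.\<close>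
      have lt: "(\<Sum>k<M. G \<theta> (xs k)) < ennreal (real M * K)"
        using nT xs(1) by (simp add: T_def not_le)
      then have fin: "G \<theta> (xs k) < \<infinity>" if "k < M" for k
      proof -
        have "G \<theta> (xs k) \<le> (\<Sum>k<M. G \<theta> (xs k))" using that by (intro member_le_sum) auto
        also note lt
        also have "ennreal (real M * K) < \<infinity>" by simp
        finally show ?thesis .
      qed
      have "\<exists>t\<in>\<Theta>'. infnorm (t - \<theta>) \<le> e \<and> gradient (\<lambda>t. \<Sum>k<M. loglik p (xs k) t) t = 0"
      proof (rule stationary_point_in_cube[where r=r0 and A="A \<theta>" and F="F \<theta>" and B=B and \<kappa>=\<kappa> and \<eta>=\<eta> and K=K
            and G="\<lambda>k. enn2real (G \<theta> (xs k))"])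
        show "\<bar>\<Sum>k<M. (A \<theta> *v score (xs k) \<theta>) $ a\<bar> \<le> real M * ((1 - \<kappa>) * e)" for a
        proof -
          have "\<bar>\<Sum>k<M. (A \<theta> *v score (xs k) \<theta>) $ a\<bar> \<le> t * sqrt (A \<theta> $ a $ a) * sqrt (real M)"
            using nS[of a] xs(1) by (simp add: S_def not_less flip: efficient_score_def)
          \<comment> \<open>Here the variance at \<open>\<theta>\<close> is replaced by the worst
            one, so that the condition on \<open>M\<close> is free of \<open>\<theta>\<close> and
            \<open>a\<close>.\<close>
          also have "\<dots> \<le> t * sqrt V * sqrt (real M)"
            using t fisher_inv_le_worst_variance[OF \<theta>, of a] by (intro mult_right_mono mult_left_mono) auto
          finally show ?thesis using tM by linarith
        qed
        show "\<bar>\<Sum>k<M. ?Y i j (xs k)\<bar> \<le> real M * \<eta>" for i j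
          using nH[of i j] xs(1) by (simp add: H_def not_le)
        have "ennreal (\<Sum>k<M. enn2real (G \<theta> (xs k))) = (\<Sum>k<M. G \<theta> (xs k))"
          using fin by (subst sum_ennreal[symmetric]) (auto intro!: sum.cong)
        then show "(\<Sum>k<M. enn2real (G \<theta> (xs k))) \<le> real M * K"
          using lt K(1) by (metis ennreal_le_iff less_imp_le mult_nonneg_nonneg of_nat_0_le_iff)
        have "?d * (B * (?d * (\<eta> * e) + ?d\<^sup>2 * K * e\<^sup>2)) = (?d\<^sup>2 * B * \<eta>) * e + (?d ^ 3 * B * K * e) * e"
          by (simp add: algebra_simps power2_eq_square power3_eq_cube)
        also have "\<dots> \<le> (\<kappa> / 2) * e + (\<kappa> / 2) * e"
        proof (intro add_mono mult_right_mono)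
          have "?d\<^sup>2 * B * \<eta> \<le> ?d\<^sup>2 * (B + 1) * \<eta>"
            using \<eta> by (intro mult_right_mono mult_left_mono) auto
          also have "?d\<^sup>2 * (B + 1) * \<eta> = \<kappa> / 2"
          proof -
            have "2 * ?d\<^sup>2 * (B + 1) \<noteq> 0" using B(1) d by auto
            then show ?thesis unfolding \<eta>_def by (simp add: divide_eq_eq del: distrib_left_numeral)
          qed
          finally show "?d\<^sup>2 * B * \<eta> \<le> \<kappa> / 2" .
          have "?d ^ 3 * B * K * e \<le> ?d ^ 3 * (B + 1) * K * (\<kappa> / (2 * ?d ^ 3 * (B + 1) * K))"
            using e K(1) B(1) by (intro mult_mono) (auto simp: e0_def)
          also have "\<dots> = \<kappa> / 2" using K(1) B(1) d by simp
          finally show "?d ^ 3 * B * K * e \<le> \<kappa> / 2" .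
        qed (use e in auto)
        finally show "?d * (B * (?d * (\<eta> * e) + ?d\<^sup>2 * K * e\<^sup>2)) \<le> \<kappa> * e" by simp
        show "?d * e \<le> r0"
          using e(2) d by (simp add: e0_def field_simps)
        show "C3_on \<Theta>' (loglik p (xs k))" if "k < M" for k
          using xk[OF that] by (rule loglik_C3)
        show "\<bar>third_deriv (loglik p (xs k)) (\<theta> + D) $ i $ j $ l\<bar> \<le> enn2real (G \<theta> (xs k))"
          if "k < M" "norm D \<le> r0" for k D i j l
          using G(3)[OF \<theta> xk[OF that(1)] fin[OF that(1)] that(2)] .
      qed (use R1 \<theta> M_ge fisher_inverse[OF \<theta>] B(2)[OF \<theta>] e in auto)
      then have "xs \<in> stationary_event M \<theta> e"
        using xs(1) by (auto simp: stationary_event_def sample_loglik_def[abs_def])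
      with xs(2) show False by contradiction
    qed
    have "measure ?Q (space ?Q - stationary_event M \<theta> e)
        \<le> measure ?Q ((\<Union>a. S a) \<union> (\<Union>z. H (fst z) (snd z)) \<union> T)"
      by (intro Q.finite_measure_mono[OF sub]) measurable
    also have "\<dots> \<le> measure ?Q ((\<Union>a. S a) \<union> (\<Union>z. H (fst z) (snd z))) + measure ?Q T"
      by (intro measure_Un_le) measurable
    also have "measure ?Q ((\<Union>a. S a) \<union> (\<Union>z. H (fst z) (snd z))) \<le> measure ?Q (\<Union>a. S a) + measure ?Q (\<Union>z. H (fst z) (snd z))"
      by (intro measure_Un_le) measurable
    also have "measure ?Q (\<Union>a. S a) \<le> (\<Sum>a\<in>UNIV. measure ?Q (S a))"
      by (intro measure_UNION_le finite Sm)
    also have "\<dots> \<le> (\<Sum>a\<in>(UNIV :: 'd set). 2 * (std_normal_density t / t) + gap / (4 * ?d))"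
      using score[OF M_ge(2) \<theta>] by (intro sum_mono less_imp_le) (auto simp: S_def)
    also have "\<dots> = ?d * (2 * (std_normal_density t / t)) + gap / 4"
      using d by (simp add: distrib_left)
    also have "measure ?Q (\<Union>z. H (fst z) (snd z)) \<le> (\<Sum>z\<in>UNIV. measure ?Q (H (fst z) (snd z)))"
      by (intro measure_UNION_le finite Hm)
    also have "\<dots> \<le> (\<Sum>z\<in>(UNIV :: ('d \<times> 'd) set). gap / (4 * ?d\<^sup>2))"
      by (intro sum_mono mH)
    also have "\<dots> = gap / 4" using d by (simp add: power2_eq_square)
    also note mT
    finally have "measure ?Q (space ?Q - stationary_event M \<theta> e)
        \<le> ?d * (2 * (std_normal_density t / t)) + gap / 4 + gap / 4 + gap / 4" by simp
    moreover have "?d * (2 * (std_normal_density t / t)) = \<delta> - gap" by (simp add: gap_def)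
    ultimately have "measure ?Q (space ?Q - stationary_event M \<theta> e) \<le> \<delta> - gap + gap / 4 + gap / 4 + gap / 4"
      by simp
    then have "measure ?Q (space ?Q - stationary_event M \<theta> e) \<le> \<delta>"
      using gap by linarith
    then have "1 - \<delta> \<le> measure ?Q (stationary_event M \<theta> e)"
      using Q.prob_compl[OF E] by simp
    then show "1 - \<delta> \<le> measure (completion ?Q) {xs \<in> space ?Q. infnorm (mle \<Theta> p M xs - \<theta>) \<le> e}"
      using ml_event_probability[OF M_ge(1) \<theta>] by simp
  qed
  moreover have "1 \<le> M0" using M1 by (simp add: M0_def)
  ultimately show ?thesis using e0 by blast
qed

end

subsection \<open>The Lambert function and the asymptotic bound\<close>

text \<open>For y > 0 every solution of w e^w = y is positive, and w e^w is strictly increasing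
  there, so the description in \<open>lambert_W0\<close> is unique. A solution exists in [0, y]
  because y e^y \<ge> y.\<close>

lemma lambert_W0_pos:
  assumes y: "0 < y"
  shows "0 < lambert_W0 y" "lambert_W0 y * exp (lambert_W0 y) = y"
proof -
  have pos: "0 < w" if "w * exp w = y" for w :: real
    using y that zero_less_mult_iff[of w "exp w"] by auto
  have "\<exists>w. 0 \<le> w \<and> w \<le> y \<and> w * exp w = y"
    using y by (intro IVT') (auto intro!: continuous_intros)
  then obtain w where w: "w * exp w = y" by blast
  have "\<exists>!w. - 1 \<le> w \<and> w * exp w = y"
  proof (intro ex1I[of _ w] conjI w)
    show "- 1 \<le> w" using pos[OF w] by simp
    fix v assume "- 1 \<le> v \<and> v * exp v = y"
    then have v: "v * exp v = y" by blast
    have less: "a * exp a < b * exp b" if "0 < a" "a < b" for a b :: real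
      using that by (intro mult_strict_mono) auto
    show "v = w"
      using less[OF pos[OF v], of w] less[OF pos[OF w], of v] v w by (cases v w rule: linorder_cases) auto
  qed
  from theI'[OF this] show W: "lambert_W0 y * exp (lambert_W0 y) = y"
    unfolding lambert_W0_def by blast
  then show "0 < lambert_W0 y" by (rule pos)
qed

text \<open>Both sides are nonnegative, so squares are compared: with t^2 = W the left one is 2 d^2
  / (pi W e^W), and the equation for W turns it into \<delta>^2 / 4.\<close>

lemma mills_ratio_lambert_W0:
  assumes \<delta>: "0 < \<delta>" and d: "0 < d"
  defines "t \<equiv> sqrt (lambert_W0 (8 * d\<^sup>2 / (pi * \<delta>\<^sup>2)))"
  shows "d * (2 * (std_normal_density t / t)) = \<delta> / 2"
proof -
  let ?W = "lambert_W0 (8 * d\<^sup>2 / (pi * \<delta>\<^sup>2))"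
  have "0 < 8 * d\<^sup>2 / (pi * \<delta>\<^sup>2)" using \<delta> d by simp
  note W = lambert_W0_pos[OF this]
  have t: "0 < t" "t\<^sup>2 = ?W" using W(1) by (simp_all add: t_def)
  have "(d * (2 * (std_normal_density t / t)))\<^sup>2 = 4 * d\<^sup>2 * (exp (- ?W / 2))\<^sup>2 / (2 * pi * ?W)"
    using t by (simp add: std_normal_density_def power_mult_distrib power_divide)
  also have "(exp (- ?W / 2))\<^sup>2 = 1 / exp ?W"
    by (simp add: exp_minus field_simps flip: exp_double)
  also have "4 * d\<^sup>2 * (1 / exp ?W) / (2 * pi * ?W) = 2 * d\<^sup>2 / (pi * (?W * exp ?W))"
    using W(1) by (simp add: field_simps)
  also have "\<dots> = (\<delta> / 2)\<^sup>2"
    unfolding W(2) using \<delta> d by (simp add: field_simps power2_eq_square)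
  finally show ?thesis
  proof (rule power2_eq_imp_eq)
    show "0 \<le> d * (2 * (std_normal_density t / t))"
      using d t(1) normal_density_nonneg[of 1 0 t] by (intro mult_nonneg_nonneg divide_nonneg_pos) auto
  qed (use \<delta> in simp)
qed

context regular_model
begin

lemma min_repetitions_bound:
  assumes \<delta>: "0 < \<delta>" and \<xi>: "0 < \<xi>"
  defines "c \<equiv> lambert_W0 (8 * real CARD('d) ^ 2 / (pi * \<delta>\<^sup>2)) * V"
  shows "\<forall>\<^sub>F e in at_right 0. ereal_of_enat (min_repetitions \<mu> \<Theta> p \<delta> e) \<le> ereal ((1 + \<xi>) * (c / e\<^sup>2))"
proof -
  let ?W = "lambert_W0 (8 * real CARD('d) ^ 2 / (pi * \<delta>\<^sup>2))"
  have "0 < 8 * real CARD('d) ^ 2 / (pi * \<delta>\<^sup>2)" using \<delta> by simp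
  note W = lambert_W0_pos(1)[OF this]
  have c: "0 < c" using W worst_variance_pos by (simp add: c_def)
  \<comment> \<open>Half of \<open>\<xi>\<close> pays for the loss \<open>\<kappa>\<close>: as
    \<open>1 - \<kappa> = 1 / s\<close>, the condition on \<open>M\<close> reads
    \<open>s\<^sup>2 * c \<le> real M * e\<^sup>2\<close>. The other half absorbs the rounding up to
    an integer, which is less than \<open>(\<xi> / 2) * (c / e\<^sup>2)\<close> for small
    \<open>e\<close>.\<close>
  define s where "s = sqrt (1 + \<xi> / 2)"
  have s: "1 < s" "s\<^sup>2 = 1 + \<xi> / 2" using \<xi> by (auto simp: s_def)
  define \<kappa> where "\<kappa> = 1 - 1 / s"
  have \<kappa>: "0 < \<kappa>" "\<kappa> < 1" using s by (auto simp: \<kappa>_def)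
  have "real CARD('d) * (2 * (std_normal_density (sqrt ?W) / sqrt ?W)) < \<delta>"
  proof -
    have eq: "real CARD('d) * (2 * (std_normal_density (sqrt ?W) / sqrt ?W)) = \<delta> / 2"
      by (rule mills_ratio_lambert_W0[OF \<delta>]) simp
    show ?thesis unfolding eq using \<delta> by simp
  qed
  then obtain e0 M0 where e0: "0 < e0" and M0: "1 \<le> M0"
    and good: "\<And>e M. 0 < e \<Longrightarrow> e \<le> e0 \<Longrightarrow> M0 \<le> M \<Longrightarrow>
      sqrt ?W * sqrt V * sqrt (real M) \<le> real M * ((1 - \<kappa>) * e) \<Longrightarrow> ml_guarantee \<mu> \<Theta> p \<delta> e M"
    using ml_guarantee_eventually[OF \<kappa>, of "sqrt ?W" \<delta>] W by auto
  have top: "filterlim (\<lambda>e::real. k * (c / e\<^sup>2)) at_top (at_right 0)" if "0 < k" for k :: real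
    using that c by real_asymp
  have "\<forall>\<^sub>F e in at_right 0. real M0 \<le> 1 * (c / e\<^sup>2)"
    using top[of 1] unfolding filterlim_at_top by auto
  moreover have "\<forall>\<^sub>F e in at_right 0. 1 \<le> (\<xi> / 2) * (c / e\<^sup>2)"
    using top[of "\<xi> / 2"] \<xi> unfolding filterlim_at_top by auto
  moreover have "\<forall>\<^sub>F e in at_right 0. e < e0"
    using e0 eventually_at_right_real[of 0 e0] by (auto elim: eventually_mono)
  moreover have "\<forall>\<^sub>F e::real in at_right 0. 0 < e"
    by (rule eventually_at_right_less)
  ultimately show ?thesis
  proof eventually_elim
    case (elim e)
    let ?n = "nat \<lceil>(1 + \<xi> / 2) * (c / e\<^sup>2)\<rceil>"
    have ce: "0 < c / e\<^sup>2" using c elim by simp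
    then have low: "1 * (c / e\<^sup>2) \<le> (1 + \<xi> / 2) * (c / e\<^sup>2)" using \<xi> by (intro mult_right_mono) auto
    have n_ge: "(1 + \<xi> / 2) * (c / e\<^sup>2) \<le> real ?n" by linarith
    have n_le: "real ?n \<le> (1 + \<xi> / 2) * (c / e\<^sup>2) + 1" using low ce by linarith
    have M0n: "M0 \<le> ?n" using elim(1) low n_ge by linarith
    have "ml_guarantee \<mu> \<Theta> p \<delta> e M" if M: "?n \<le> M" for M
    proof (rule good)
      show "M0 \<le> M" using M0n M by (rule order_trans)
      have M': "(1 + \<xi> / 2) * (c / e\<^sup>2) \<le> real M" using n_ge M by linarith
      then have "s\<^sup>2 * c \<le> real M * e\<^sup>2" 
        using elim(4) unfolding s(2)[symmetric] by (simp add: pos_divide_le_eq)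
      then have "sqrt (s\<^sup>2 * c) \<le> sqrt (real M * e\<^sup>2)" by (rule real_sqrt_le_mono)
      then have "s * sqrt c \<le> sqrt (real M) * e" using s(1) elim(4) by (simp add: real_sqrt_mult)
      then have "sqrt c \<le> sqrt (real M) * ((1 - \<kappa>) * e)"
        using s(1) by (simp add: \<kappa>_def field_simps)
      then have "sqrt c * sqrt (real M) \<le> (sqrt (real M) * ((1 - \<kappa>) * e)) * sqrt (real M)"
        by (rule mult_right_mono) simp
      also have "\<dots> = real M * ((1 - \<kappa>) * e)" by (simp add: algebra_simps)
      finally show "sqrt ?W * sqrt V * sqrt (real M) \<le> real M * ((1 - \<kappa>) * e)"
        by (simp add: c_def real_sqrt_mult)
    qed (use elim in auto)
    then have "min_repetitions \<mu> \<Theta> p \<delta> e \<le> enat ?n"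
      unfolding min_repetitions_def using M0n M0 by (intro INF_lower) auto
    then have "ereal_of_enat (min_repetitions \<mu> \<Theta> p \<delta> e) \<le> ereal_of_enat (enat ?n)"
      by (simp only: ereal_of_enat_le_iff)
    also have "\<dots> = ereal (real ?n)" by simp
    also have "real ?n \<le> (1 + \<xi>) * (c / e\<^sup>2)"
    proof -
      have "real ?n \<le> (1 + \<xi> / 2) * (c / e\<^sup>2) + (\<xi> / 2) * (c / e\<^sup>2)"
        using n_le elim(2) by (rule order_trans[OF _ add_left_mono])
      also have "\<dots> = (1 + \<xi>) * (c / e\<^sup>2)" unfolding distrib_right[symmetric] by simp
      finally show ?thesis .
    qed
    finally show ?case by simp
  qed
qed

end

lemma asymp_le_at_0I:
  assumes B: "\<And>e. 0 < e \<Longrightarrow> 0 < B e"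
    and le: "\<And>\<xi>. 0 < \<xi> \<Longrightarrow> \<forall>\<^sub>F e in at_right 0. ereal_of_enat (f e) \<le> ereal ((1 + \<xi>) * B e)"
  shows "asymp_le_at_0 f B"
  unfolding asymp_le_at_0_def
proof (rule ereal_le_epsilon2)
  fix \<xi> :: real assume \<xi>: "0 < \<xi>"
  have "\<forall>\<^sub>F e::real in at_right 0. 0 < e" by (rule eventually_at_right_less)
  with le[OF \<xi>] have "\<forall>\<^sub>F e in at_right 0. ereal_of_enat (f e) / ereal (B e) \<le> ereal (1 + \<xi>)"
  proof eventually_elim
    case (elim e)
    then show ?case
      using B[of e] by (subst ereal_divide_le_pos) (auto simp: mult.commute)
  qed
  then show "Limsup (at_right 0) (\<lambda>e. ereal_of_enat (f e) / ereal (B e)) \<le> 1 + ereal \<xi>"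
    by (intro Limsup_bounded) (simp add: one_ereal_def)
qed

theorem theorem1:
  fixes \<mu> :: "'x measure"
    and p :: "real^'d::finite \<Rightarrow> 'x \<Rightarrow> real"
    and \<Theta> \<Theta>' :: "(real^'d) set"
    and r0 \<delta> :: real
    and N :: nat
  assumes model_nonempty: "\<Theta> \<noteq> {}"
    and model_measurable: "\<And>\<theta>. \<theta> \<in> \<Theta>' \<Longrightarrow> p \<theta> \<in> borel_measurable \<mu>"
    and model_pos: "\<And>\<theta> x. \<theta> \<in> \<Theta>' \<Longrightarrow> x \<in> space \<mu> \<Longrightarrow> p \<theta> x > 0"
    and model_prob: "\<And>\<theta>. \<theta> \<in> \<Theta> \<Longrightarrow> prob_space (law \<mu> p \<theta>)"
    and score_mean: "\<And>\<theta>. \<theta> \<in> \<Theta> \<Longrightarrow>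
          has_bochner_integral (law \<mu> p \<theta>) (\<lambda>x. gradient (loglik p x) \<theta>) 0"
    and fisher_exists: "\<And>\<theta>. \<theta> \<in> \<Theta> \<Longrightarrow>
          integrable (law \<mu> p \<theta>) (\<lambda>x. outer_square (gradient (loglik p x) \<theta>))"
    and hessian_mean: "\<And>\<theta>. \<theta> \<in> \<Theta> \<Longrightarrow>
          has_bochner_integral (law \<mu> p \<theta>) (\<lambda>x. hessian (loglik p x) \<theta>) (- fisher \<mu> p \<theta>)"
    and A1: "\<And>M \<theta>. 1 \<le> M \<Longrightarrow> \<theta> \<in> \<Theta> \<Longrightarrow> AE xs in iid_law \<mu> p M \<theta>.
          (\<exists>!t. is_arg_max (sample_loglik p M xs) (\<lambda>t. t \<in> \<Theta>) t) \<and>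
          mle \<Theta> p M xs \<in> interior \<Theta> \<and>
          {t \<in> \<Theta>'. gradient (sample_loglik p M xs) t = 0} = {mle \<Theta> p M xs}"
    and A2: "\<And>M xs. 1 \<le> M \<Longrightarrow> xs \<in> space (\<Pi>\<^sub>M i\<in>{..<M}. \<mu>) \<Longrightarrow> C3_on \<Theta>' (sample_loglik p M xs)"
    and R1: "open \<Theta>'" "\<Theta> \<subseteq> \<Theta>'" "0 < r0"
          "\<And>\<theta> \<Delta>. \<theta> \<in> \<Theta> \<Longrightarrow> norm \<Delta> \<le> r0 \<Longrightarrow> \<theta> + \<Delta> \<in> \<Theta>'"
    and R2: "\<And>\<theta>. \<theta> \<in> \<Theta> \<Longrightarrow> invertible (fisher \<mu> p \<theta>)"
          "bdd_above ((\<lambda>\<theta>. matrix_opnorm (fisher_inv \<mu> p \<theta>)) ` \<Theta>)"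
    and R3: "(SUP \<theta>\<in>\<Theta>. \<integral>\<^sup>+x. ennreal (trace
            ((hessian (loglik p x) \<theta> + fisher \<mu> p \<theta>) ** (hessian (loglik p x) \<theta> + fisher \<mu> p \<theta>)))
            \<partial>law \<mu> p \<theta>) < \<infinity>"
    and R4: "(SUP \<theta>\<in>\<Theta>. \<integral>\<^sup>+x. (SUP \<Delta>\<in>cball 0 r0.
            ennreal (tensor_opnorm (third_deriv (loglik p x) (\<theta> + \<Delta>))))\<^sup>2 \<partial>law \<mu> p \<theta>) < \<infinity>"
    and R5: "(SUP \<theta>\<in>\<Theta>. SUP u\<in>sphere 0 1.
            (\<integral>\<^sup>+x. ennreal (\<bar>u \<bullet> (fisher_inv \<mu> p \<theta> *v gradient (loglik p x) \<theta>)\<bar> ^ 3) \<partial>law \<mu> p \<theta>) /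
            ennreal ((u \<bullet> (fisher_inv \<mu> p \<theta> *v u)) powr (3 / 2))) < \<infinity>"
    and \<delta>: "0 < \<delta>" "\<delta> \<le> 1"
    and N: "1 \<le> N"
  shows "asymp_le_at_0 (min_repetitions \<mu> \<Theta> p \<delta>)
           (\<lambda>\<epsilon>. lambert_W0 (8 * real CARD('d) ^ 2 / (pi * \<delta>\<^sup>2)) * worst_variance \<mu> \<Theta> p / \<epsilon>\<^sup>2) \<and>
         asymp_le_at_0 (min_sample_complexity N \<mu> \<Theta> p \<delta>)
           (\<lambda>\<epsilon>. real N * lambert_W0 (8 * real CARD('d) ^ 2 / (pi * \<delta>\<^sup>2)) * worst_variance \<mu> \<Theta> p / \<epsilon>\<^sup>2)"
proof -
  interpret regular_model \<mu> p \<Theta> \<Theta>' r0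
  proof (rule regular_model.intro)
    show "AE xs in iid_law \<mu> p M \<theta>.
        {t \<in> \<Theta>'. gradient (sample_loglik p M xs) t = 0} = {mle \<Theta> p M xs}"
      if "1 \<le> M" "\<theta> \<in> \<Theta>" for M \<theta>
      using A1[OF that] by eventually_elim blast
  qed fact+
  define c where "c = lambert_W0 (8 * real CARD('d) ^ 2 / (pi * \<delta>\<^sup>2)) * worst_variance \<mu> \<Theta> p"
  have "0 < 8 * real CARD('d) ^ 2 / (pi * \<delta>\<^sup>2)" using \<delta> by simp
  from lambert_W0_pos(1)[OF this] worst_variance_pos have c: "0 < c" by (simp add: c_def)
  have reps: "\<forall>\<^sub>F e in at_right 0.
      ereal_of_enat (min_repetitions \<mu> \<Theta> p \<delta> e) \<le> ereal ((1 + \<xi>) * (c / e\<^sup>2))" if "0 < \<xi>" for \<xi>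
    unfolding c_def using min_repetitions_bound[OF \<delta>(1) that] .
  have "asymp_le_at_0 (min_repetitions \<mu> \<Theta> p \<delta>) (\<lambda>e. c / e\<^sup>2)"
    using c reps by (intro asymp_le_at_0I) auto
  moreover have "asymp_le_at_0 (min_sample_complexity N \<mu> \<Theta> p \<delta>) (\<lambda>e. real N * c / e\<^sup>2)"
  proof (rule asymp_le_at_0I)
    fix \<xi> :: real assume "0 < \<xi>"
    from reps[OF this]
    show "\<forall>\<^sub>F e in at_right 0.
        ereal_of_enat (min_sample_complexity N \<mu> \<Theta> p \<delta> e) \<le> ereal ((1 + \<xi>) * (real N * c / e\<^sup>2))"
    proof eventually_elim
      case (elim e)
      have "ereal_of_enat (min_sample_complexity N \<mu> \<Theta> p \<delta> e)
          = ereal (real N) * ereal_of_enat (min_repetitions \<mu> \<Theta> p \<delta> e)"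
        by (simp add: min_sample_complexity_def ereal_of_enat_mult)
      also have "\<dots> \<le> ereal (real N) * ereal ((1 + \<xi>) * (c / e\<^sup>2))"
        using elim by (intro ereal_mult_left_mono) auto
      finally show ?case by (simp add: mult_ac)
    qed
  qed (use c N in auto)
  ultimately show ?thesis by (simp add: c_def mult.assoc)
qed

end
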